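(* Let $R$ be a commutative ring with $1$, let $m\ge 0$ and $n\ge 1$ be integers, and let $E^m$ be the Grassmann algebra of rank $m$ over $R$. Let $A\in M_nE^m$, let $A_0\in M_nR$ be its degree zero component, and let $f(x)=\det(xI-A_0)\in R[x]$ be the characteristic polynomial of $A_0$. Then $$f(A)^{\lceil m/2\rceil+1}=0.$$
   Context: The Grassmann algebra of rank $m$ over $R$ is the $R$-algebra $E^m=R\langle v_1,\dots,v_m\rangle/(v_k^2,\ v_iv_j+v_jv_i\mid 1\le k\le m,\ 1\le i<j\le m)$. It is a graded $R$-algebra with each $v_i$ of degree $1$: $E^m=\bigoplus_{i=0}^m E^m_i$, with $E^m_0=R$ and $E^m_m=Rv_1\cdots v_m$. For a set $X$, $M_nX$ denotes the set of $n\times n$ matrices with entries in $X$. Every $A\in M_nE^m$ decomposes uniquely as $A=\sum_{i=0}^m A_i$ with $A_i\in M_nE^m_i$; $A_0\in M_nR$ is the degree zero component. *)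

theory Defs
  imports
    "HOL-Library.Poly_Mapping"
    "HOL-Library.Type_Length"
    "Jordan_Normal_Form.Char_Poly"
begin

text \<open>
  The rank \<open>m\<close> is the length \<open>LENGTH('m)\<close> of a type \<open>'m :: len0\<close>, so that rank \<open>0\<close> is included
  (\<open>LENGTH(0) = 0\<close>) and every natural number is the length of a numeral type.
  Words in the letters \<open>1, \<dots>, m\<close> form the free monoid, written additively, and the free algebra
  \<open>R\<langle>v\<^sub>1, \<dots>, v\<^sub>m\<rangle>\<close> is its monoid algebra, provided by \<open>poly_mapping\<close>.
\<close>

typedef (overloaded) 'm gword = "{w :: nat list. set w \<subseteq> {1..LENGTH('m::len0)}}"
  morphisms letters Gword
  by (rule exI[of _ "[]"]) simp

setup_lifting type_definition_gword

instantiation gword :: (len0) monoid_add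
begin

lift_definition zero_gword :: "'a gword" is "[]" by simp

lift_definition plus_gword :: "'a gword \<Rightarrow> 'a gword \<Rightarrow> 'a gword" is "(@)" by simp

instance by standard (transfer, simp)+

end

type_synonym ('m, 'r) free_alg = "'m gword \<Rightarrow>\<^sub>0 'r"

definition free_var :: "nat \<Rightarrow> ('m::len0, 'r::comm_ring_1) free_alg" where
  "free_var k = Poly_Mapping.single (Gword [k]) 1"

inductive_set two_sided_ideal :: "'a::ring_1 set \<Rightarrow> 'a set" for S where
  zero: "0 \<in> two_sided_ideal S"
| mult: "s \<in> S \<Longrightarrow> a * s * b \<in> two_sided_ideal S"
| add: "x \<in> two_sided_ideal S \<Longrightarrow> y \<in> two_sided_ideal S \<Longrightarrow> x + y \<in> two_sided_ideal S"

definition grassmann_relations :: "('m::len0, 'r::comm_ring_1) free_alg set" where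
  "grassmann_relations =
     {free_var k * free_var k | k. k \<in> {1..LENGTH('m)}} \<union>
     {free_var i * free_var j + free_var j * free_var i | i j. 1 \<le> i \<and> i < j \<and> j \<le> LENGTH('m)}"

lemma two_sided_ideal_left: "x \<in> two_sided_ideal S \<Longrightarrow> a * x \<in> two_sided_ideal S"
proof (induction rule: two_sided_ideal.induct)
  case (mult s b c)
  then show ?case
    using two_sided_ideal.mult[of s S "a * b" c] by (simp only: mult.assoc)
qed (simp_all add: distrib_left two_sided_ideal.zero two_sided_ideal.add)

lemma two_sided_ideal_right: "x \<in> two_sided_ideal S \<Longrightarrow> x * a \<in> two_sided_ideal S"
proof (induction rule: two_sided_ideal.induct)
  case (mult s b c)
  then show ?case
    using two_sided_ideal.mult[of s S b "c * a"] by (simp only: mult.assoc)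
qed (simp_all add: distrib_right two_sided_ideal.zero two_sided_ideal.add)

lemma two_sided_ideal_uminus: "x \<in> two_sided_ideal S \<Longrightarrow> - x \<in> two_sided_ideal S"
  using two_sided_ideal_left[of x S "-1"] by simp

lemma two_sided_ideal_diff:
  "x \<in> two_sided_ideal S \<Longrightarrow> y \<in> two_sided_ideal S \<Longrightarrow> x - y \<in> two_sided_ideal S"
  using two_sided_ideal.add[of x S "- y"] two_sided_ideal_uminus[of y S] by simp

lemma two_sided_ideal_eq: "x = y \<Longrightarrow> x - y \<in> two_sided_ideal S"
  by (simp add: two_sided_ideal.zero)

lemma poly_mapping_expand:
  "p = (\<Sum>w\<in>Poly_Mapping.keys p. Poly_Mapping.single w (Poly_Mapping.lookup p w))"
  by (rule poly_mapping_eqI)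
     (simp add: lookup_sum lookup_single when_def in_keys_iff)

lemma two_sided_ideal_monomial_induct [consumes 1, case_names zero mult add]:
  fixes S :: "('a::monoid_add \<Rightarrow>\<^sub>0 'r::ring_1) set"
  assumes "p \<in> two_sided_ideal S"
    and zero: "P 0"
    and mult: "\<And>s u c w d. s \<in> S \<Longrightarrow> P (Poly_Mapping.single u c * s * Poly_Mapping.single w d)"
    and add: "\<And>x y. P x \<Longrightarrow> P y \<Longrightarrow> P (x + y)"
  shows "P p"
  using assms(1)
proof (induction rule: two_sided_ideal.induct)
  case (mult s a b)
  have sumP: "P (sum g T)" if "\<And>t. t \<in> T \<Longrightarrow> P (g t)" "finite T"
    for g :: "'a \<Rightarrow> ('a \<Rightarrow>\<^sub>0 'r)" and T
    using that(2,1) by (induction) (auto intro: zero add)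
  have "a * s * b = (\<Sum>u\<in>Poly_Mapping.keys a. \<Sum>w\<in>Poly_Mapping.keys b.
      Poly_Mapping.single u (Poly_Mapping.lookup a u) * s *
      Poly_Mapping.single w (Poly_Mapping.lookup b w))"
    by (simp flip: sum_distrib_left sum_distrib_right poly_mapping_expand)
  then show ?case
    by (auto intro!: sumP assms(3) mult)
qed (auto intro: zero add)

text \<open>
  \<open>free_part i p\<close> is the degree \<open>i\<close> component of \<open>p\<close> in the grading by word length.
\<close>

lift_definition free_part :: "nat \<Rightarrow> ('m::len0, 'r::comm_ring_1) free_alg \<Rightarrow> ('m, 'r) free_alg"
  is "\<lambda>i p w. if length (letters w) = i then p w else 0"
  by (rule finite_subset) auto

lemma lookup_free_part:
  "Poly_Mapping.lookup (free_part i p) w =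
     (if length (letters w) = i then Poly_Mapping.lookup p w else 0)"
  by transfer simp

lemma free_part_add: "free_part i (p + q) = free_part i p + free_part i q"
  by (rule poly_mapping_eqI) (simp add: lookup_free_part lookup_add)

lemma free_part_diff: "free_part i (p - q) = free_part i p - free_part i q"
  by (rule poly_mapping_eqI) (simp add: lookup_free_part lookup_minus)

lemma free_part_single:
  "free_part i (Poly_Mapping.single w c) =
     (if length (letters w) = i then Poly_Mapping.single w c else 0)"
  by (rule poly_mapping_eqI) (auto simp: lookup_free_part lookup_single when_def)

lemma length_letters_add: "length (letters (u + w)) = length (letters u) + length (letters w)"
  by transfer simp

lemma letters_Gword [simp]:
  "k \<in> {1..LENGTH('m)} \<Longrightarrow> letters (Gword [k] :: 'm::len0 gword) = [k]"
  by (subst Gword_inverse) auto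

lemma grassmann_relation_shape:
  fixes s :: "('m::len0, 'r::comm_ring_1) free_alg"
  assumes "s \<in> grassmann_relations"
  obtains x y :: "'m gword" and e :: 'r
  where "length (letters x) = 2" "length (letters y) = 2"
    "s = Poly_Mapping.single x 1 + Poly_Mapping.single y e"
proof -
  have "(\<exists>k. k \<in> {1..LENGTH('m)} \<and> s = free_var k * free_var k) \<or>
      (\<exists>i j. i \<in> {1..LENGTH('m)} \<and> j \<in> {1..LENGTH('m)} \<and>
        s = free_var i * free_var j + free_var j * free_var i)"
    using assms unfolding grassmann_relations_def
  proof
    assume "s \<in> {free_var i * free_var j + free_var j * free_var i | i j.
      1 \<le> i \<and> i < j \<and> j \<le> LENGTH('m)}"
    then obtain i j where "1 \<le> i" "i < j" "j \<le> LENGTH('m)"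
      and s: "s = free_var i * free_var j + free_var j * free_var i"
      by blast
    then have "i \<in> {1..LENGTH('m)}" "j \<in> {1..LENGTH('m)}"
      by simp_all
    with s show ?thesis by blast
  qed blast
  then consider (1) k where "k \<in> {1..LENGTH('m)}" "s = free_var k * free_var k"
    | (2) i j where "i \<in> {1..LENGTH('m)}" "j \<in> {1..LENGTH('m)}"
        "s = free_var i * free_var j + free_var j * free_var i"
    by blast
  then show thesis
  proof cases
    case 1
    then show thesis
      by (intro that[of "Gword [k] + Gword [k]" "Gword [k] + Gword [k]" 0])
         (simp_all add: length_letters_add free_var_def mult_single)
  next
    case 2
    then show thesis
      by (intro that[of "Gword [i] + Gword [j]" "Gword [j] + Gword [i]" 1])
         (simp_all add: length_letters_add free_var_def mult_single)
  qed
qed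

lemma free_part_grassmann_ideal:
  fixes p :: "('m::len0, 'r::comm_ring_1) free_alg"
  assumes "p \<in> two_sided_ideal grassmann_relations"
  shows "free_part i p \<in> two_sided_ideal grassmann_relations"
  using assms
proof (induction rule: two_sided_ideal_monomial_induct)
  case zero
  have "free_part i (0 :: ('m, 'r) free_alg) = 0"
    by (rule poly_mapping_eqI) (simp add: lookup_free_part)
  then show ?case by (simp add: two_sided_ideal.zero)
next
  case (mult s u c w d)
  then obtain x y :: "'m gword" and e :: 'r
    where xy: "length (letters x) = 2" "length (letters y) = 2"
      "s = Poly_Mapping.single x 1 + Poly_Mapping.single y e"
    by (rule grassmann_relation_shape)
  let ?t = "Poly_Mapping.single u c * s * Poly_Mapping.single w d"
  have "free_part i ?t = (if length (letters u) + 2 + length (letters w) = i then ?t else 0)"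
    by (simp add: xy distrib_left distrib_right mult_single free_part_add free_part_single
        length_letters_add)
  then show ?case
    using mult by (simp only: two_sided_ideal.mult two_sided_ideal.zero split: if_split) simp
qed (simp add: free_part_add two_sided_ideal.add)

lemma lookup_zero_grassmann_ideal:
  fixes p :: "('m::len0, 'r::comm_ring_1) free_alg"
  assumes "p \<in> two_sided_ideal grassmann_relations"
  shows "Poly_Mapping.lookup p 0 = 0"
  using assms
proof (induction rule: two_sided_ideal_monomial_induct)
  case (mult s u c w d)
  then obtain x y :: "'m gword" and e :: 'r
    where xy: "length (letters x) = 2" "length (letters y) = 2"
      "s = Poly_Mapping.single x 1 + Poly_Mapping.single y e"
    by (rule grassmann_relation_shape)
  have "z \<noteq> 0" if "length (letters z) \<ge> 2" for z :: "'m gword"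
    using that by transfer auto
  then have "u + x + w \<noteq> 0" "u + y + w \<noteq> 0"
    using xy by (auto simp: length_letters_add)
  then show ?case
    by (simp add: xy distrib_left distrib_right mult_single lookup_add lookup_single when_def)
qed (simp_all add: lookup_add)

quotient_type (overloaded) ('m, 'r) grassmann = "('m::len0, 'r::comm_ring_1) free_alg" /
  "\<lambda>p q. p - q \<in> two_sided_ideal grassmann_relations"
proof (rule equivpI)
  show "reflp (\<lambda>p q :: ('m, 'r) free_alg. p - q \<in> two_sided_ideal grassmann_relations)"
    by (rule reflpI) (simp add: two_sided_ideal.zero)
  show "symp (\<lambda>p q :: ('m, 'r) free_alg. p - q \<in> two_sided_ideal grassmann_relations)"
    by (rule sympI, drule two_sided_ideal_uminus) simp
  show "transp (\<lambda>p q :: ('m, 'r) free_alg. p - q \<in> two_sided_ideal grassmann_relations)"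
    by (rule transpI, drule (1) two_sided_ideal.add) simp
qed

instantiation grassmann :: (len0, comm_ring_1) ring_1
begin

lift_definition zero_grassmann :: "('a, 'b) grassmann" is 0 .

lift_definition one_grassmann :: "('a, 'b) grassmann" is 1 .

lift_definition plus_grassmann :: "('a, 'b) grassmann \<Rightarrow> ('a, 'b) grassmann \<Rightarrow> ('a, 'b) grassmann"
  is "(+)"
  unfolding add_diff_add by (rule two_sided_ideal.add)

lift_definition uminus_grassmann :: "('a, 'b) grassmann \<Rightarrow> ('a, 'b) grassmann"
  is uminus
  unfolding minus_diff_minus by (rule two_sided_ideal_uminus)

lift_definition minus_grassmann :: "('a, 'b) grassmann \<Rightarrow> ('a, 'b) grassmann \<Rightarrow> ('a, 'b) grassmann"
  is "(-)"
proof -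
  fix p q p' q' :: "('a, 'b) free_alg"
  assume "p - q \<in> two_sided_ideal grassmann_relations"
    "p' - q' \<in> two_sided_ideal grassmann_relations"
  then have "(p - q) - (p' - q') \<in> two_sided_ideal grassmann_relations"
    by (rule two_sided_ideal_diff)
  then show "(p - p') - (q - q') \<in> two_sided_ideal grassmann_relations"
    by (simp add: algebra_simps)
qed

lift_definition times_grassmann :: "('a, 'b) grassmann \<Rightarrow> ('a, 'b) grassmann \<Rightarrow> ('a, 'b) grassmann"
  is "(*)"
proof -
  fix p q p' q' :: "('a, 'b) free_alg"
  assume "p - q \<in> two_sided_ideal grassmann_relations"
    "p' - q' \<in> two_sided_ideal grassmann_relations"
  then have "(p - q) * p' + q * (p' - q') \<in> two_sided_ideal grassmann_relations"
    by (intro two_sided_ideal.add two_sided_ideal_left two_sided_ideal_right)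
  then show "p * p' - q * q' \<in> two_sided_ideal grassmann_relations"
    by (simp add: algebra_simps)
qed

instance
proof
  show "(0 :: ('a, 'b) grassmann) \<noteq> 1"
  proof (transfer, rule notI)
    assume "0 - 1 \<in> two_sided_ideal (grassmann_relations :: ('a, 'b) free_alg set)"
    from lookup_zero_grassmann_ideal[OF this] show False
      by (simp add: lookup_minus)
  qed
qed (transfer, rule two_sided_ideal_eq, simp add: algebra_simps)+

end

lift_definition scalar :: "'r \<Rightarrow> ('m::len0, 'r::comm_ring_1) grassmann"
  is "\<lambda>c. Poly_Mapping.single 0 c" .

lift_definition gen :: "nat \<Rightarrow> ('m::len0, 'r::comm_ring_1) grassmann"
  is free_var .

lift_definition degree_part :: "nat \<Rightarrow> ('m::len0, 'r::comm_ring_1) grassmann \<Rightarrow> ('m, 'r) grassmann"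
  is free_part
  unfolding free_part_diff[symmetric] by (rule free_part_grassmann_ideal)

text \<open>
  The degree zero component, as an element of \<open>R\<close> rather than of its copy in the algebra;
  see \<open>scalar_degree_zero\<close>.
\<close>

lift_definition degree_zero :: "('m::len0, 'r::comm_ring_1) grassmann \<Rightarrow> 'r"
  is "\<lambda>p. Poly_Mapping.lookup p 0"
  by (drule lookup_zero_grassmann_ideal) (simp add: lookup_minus)

text \<open>
  That the pieces below grade the algebra is proved in \<open>sum_degree_part\<close> and
  \<open>degree_part_unique\<close>; \<open>degree_part\<close> is the projection to a piece.
\<close>

definition graded_piece :: "nat \<Rightarrow> ('m::len0, 'r::comm_ring_1) grassmann set" where
  "graded_piece i =
     {abs_grassmann p | p. \<forall>w\<in>Poly_Mapping.keys p. length (letters w) = i}"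

lemma abs_grassmann_surj: "\<exists>p. x = abs_grassmann p"
  using Quotient3_abs_rep[OF Quotient3_grassmann, of x] by (intro exI) (rule sym)

lemma scalar_degree_zero: "scalar (degree_zero x) = degree_part 0 x"
proof (transfer)
  fix p :: "('a, 'b) free_alg"
  have *: "letters w = [] \<longleftrightarrow> w = 0" for w :: "'a gword"
    by transfer simp
  have "Poly_Mapping.single 0 (Poly_Mapping.lookup p 0) = free_part 0 p"
    by (rule poly_mapping_eqI) (auto simp: lookup_free_part lookup_single when_def *)
  then show "Poly_Mapping.single 0 (Poly_Mapping.lookup p 0) - free_part 0 p
      \<in> two_sided_ideal grassmann_relations"
    by (simp add: two_sided_ideal.zero)
qed

lemma degree_zero_scalar [simp]: "degree_zero (scalar c) = c"
  by transfer simp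

lemma degree_part_add: "degree_part i (x + y) = degree_part i x + degree_part i y"
  by transfer (simp add: free_part_add two_sided_ideal.zero)

lemma degree_part_0 [simp]: "degree_part i 0 = 0"
  using degree_part_add[of i 0 0] by simp

lemma degree_part_sum: "degree_part i (sum g T) = (\<Sum>t\<in>T. degree_part i (g t))"
  by (induction T rule: infinite_finite_induct) (simp_all add: degree_part_add)

lemma degree_part_in_graded_piece: "degree_part i x \<in> graded_piece i"
proof -
  obtain p where x: "x = abs_grassmann p"
    using abs_grassmann_surj by blast
  have "\<forall>w\<in>Poly_Mapping.keys (free_part i p). length (letters w) = i"
    by (auto simp: in_keys_iff lookup_free_part split: if_splits)
  then show ?thesis
    unfolding graded_piece_def x degree_part.abs_eq mem_Collect_eq
    by (intro exI[of _ "free_part i p"]) simp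
qed

lemma degree_part_graded_piece:
  assumes "x \<in> graded_piece i"
  shows "degree_part j x = (if j = i then x else 0)"
proof -
  obtain p where p: "x = abs_grassmann p" "\<forall>w\<in>Poly_Mapping.keys p. length (letters w) = i"
    using assms unfolding graded_piece_def by blast
  have "free_part j p = (if j = i then p else 0)"
  proof (rule poly_mapping_eqI)
    fix w
    show "Poly_Mapping.lookup (free_part j p) w =
        Poly_Mapping.lookup (if j = i then p else 0) w"
    proof (cases "w \<in> Poly_Mapping.keys p")
      case True
      with p(2) have "length (letters w) = i" by blast
      then show ?thesis by (simp add: lookup_free_part)
    next
      case False
      then have "Poly_Mapping.lookup p w = 0" by (simp add: in_keys_iff)
      then show ?thesis by (simp add: lookup_free_part)
    qed
  qed
  then show ?thesis
    by (simp add: p(1) degree_part.abs_eq zero_grassmann_def)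
qed

lemma gen_square:
  "k \<in> {1..LENGTH('m)} \<Longrightarrow> gen k * gen k = (0 :: ('m::len0, 'r::comm_ring_1) grassmann)"
proof transfer
  fix k assume "k \<in> {1..LENGTH('m)}"
  then have "1 * (free_var k * free_var k :: ('m, 'r) free_alg) * 1
      \<in> two_sided_ideal grassmann_relations"
    by (intro two_sided_ideal.mult) (auto simp: grassmann_relations_def)
  then show "(free_var k * free_var k - 0 :: ('m, 'r) free_alg)
      \<in> two_sided_ideal grassmann_relations"
    by simp
qed

lemma gen_anticommute:
  fixes i j :: nat
  assumes "i \<in> {1..LENGTH('m)}" "j \<in> {1..LENGTH('m)}"
  shows "gen i * gen j = - (gen j * gen i :: ('m::len0, 'r::comm_ring_1) grassmann)"
proof -
  have *: "gen i * gen j + gen j * gen i = (0 :: ('m, 'r) grassmann)"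
    if "1 \<le> i" "i < j" "j \<le> LENGTH('m)" for i j
    using that
  proof transfer
    fix i j assume "1 \<le> i" "i < j" "j \<le> LENGTH('m)"
    then have "1 * (free_var i * free_var j + free_var j * free_var i :: ('m, 'r) free_alg) * 1
        \<in> two_sided_ideal grassmann_relations"
      by (intro two_sided_ideal.mult) (auto simp: grassmann_relations_def)
    then show "(free_var i * free_var j + free_var j * free_var i - 0 :: ('m, 'r) free_alg)
        \<in> two_sided_ideal grassmann_relations"
      by simp
  qed
  consider "i = j" | "i < j" | "j < i" by linarith
  then show ?thesis
  proof cases
    case 1
    then show ?thesis using gen_square[OF assms(1), where ?'r = 'r] by simp
  next
    case 2
    then show ?thesis using *[of i j] assms by (simp add: eq_neg_iff_add_eq_0)
  next
    case 3
    then show ?thesis using *[of j i] assms by (simp add: eq_neg_iff_add_eq_0 add.commute)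
  qed
qed

lemma abs_grassmann_single:
  assumes "set w \<subseteq> {1..LENGTH('m)}"
  shows "abs_grassmann (Poly_Mapping.single (Gword w) c) =
     (scalar c * prod_list (map gen w) :: ('m::len0, 'r::comm_ring_1) grassmann)"
  using assms
proof (induction w rule: rev_induct)
  case Nil
  then show ?case
    by (simp add: scalar.abs_eq zero_gword_def)
next
  case (snoc k w)
  have "Gword (w @ [k]) = Gword w + (Gword [k] :: 'm gword)"
    using snoc.prems by (simp add: plus_gword.abs_eq eq_onp_def)
  then have "abs_grassmann (Poly_Mapping.single (Gword (w @ [k])) c) =
      abs_grassmann (Poly_Mapping.single (Gword w) c) * (gen k :: ('m, 'r) grassmann)"
    by (simp add: gen.abs_eq free_var_def times_grassmann.abs_eq mult_single)
  with snoc show ?case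
    by (simp add: mult.assoc)
qed

lemma gen_prod_sandwich:
  assumes "k \<in> {1..LENGTH('m)}" "set z \<subseteq> {1..LENGTH('m)}"
  shows "gen k * (prod_list (map gen z) * gen k) = (0 :: ('m::len0, 'r::comm_ring_1) grassmann)"
  using assms(2)
proof (induction z)
  case Nil
  then show ?case using gen_square[OF assms(1), where ?'r = 'r] by simp
next
  case (Cons a z)
  have comm: "gen k * gen a = - (gen a * gen k :: ('m, 'r) grassmann)"
    using assms(1) Cons.prems by (intro gen_anticommute) simp_all
  have "gen k * (prod_list (map gen (a # z)) * gen k) =
      (gen k * gen a) * (prod_list (map gen z) * (gen k :: ('m, 'r) grassmann))"
    by (simp add: mult.assoc)
  also have "\<dots> = - (gen a * (gen k * (prod_list (map gen z) * gen k)))"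
    by (simp add: comm) (simp add: mult.assoc)
  also have "\<dots> = 0"
    using Cons by simp
  finally show ?case .
qed

lemma abs_grassmann_single_long:
  fixes w :: "'m::len0 gword"
  assumes "LENGTH('m) < length (letters w)"
  shows "abs_grassmann (Poly_Mapping.single w c) = (0 :: ('m, 'r::comm_ring_1) grassmann)"
proof -
  have set_w: "set (letters w) \<subseteq> {1..LENGTH('m)}"
    using letters by blast
  have "card (set (letters w)) \<le> LENGTH('m)"
    using card_mono[OF finite_atLeastAtMost set_w] by simp
  then have "\<not> distinct (letters w)"
    using assms distinct_card[of "letters w"] by auto
  then obtain xs ys zs k where w: "letters w = xs @ [k] @ ys @ [k] @ zs"
    using not_distinct_decomp by blast
  have "gen k * (prod_list (map gen ys) * (gen k * prod_list (map gen zs))) =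
      gen k * (prod_list (map gen ys) * gen k) *
      (prod_list (map gen zs) :: ('m, 'r) grassmann)"
    by (simp only: mult.assoc)
  also have "\<dots> = 0"
    using set_w by (subst gen_prod_sandwich) (auto simp: w)
  finally have "prod_list (map gen (letters w)) = (0 :: ('m, 'r) grassmann)"
    by (simp add: w mult.assoc)
  then show ?thesis
    using abs_grassmann_single[OF set_w, of c] by (simp add: letters_inverse)
qed

lemma abs_grassmann_sum: "abs_grassmann (sum g T) = (\<Sum>t\<in>T. abs_grassmann (g t))"
  by (induction T rule: infinite_finite_induct)
     (simp_all add: zero_grassmann_def flip: plus_grassmann.abs_eq)

lemma degree_part_eq_0:
  fixes x :: "('m::len0, 'r::comm_ring_1) grassmann"
  assumes "LENGTH('m) < i"
  shows "degree_part i x = 0"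
proof -
  obtain p where x: "x = abs_grassmann p"
    using abs_grassmann_surj by blast
  have "length (letters w) = i" if "w \<in> Poly_Mapping.keys (free_part i p)" for w
    using that by (auto simp: in_keys_iff lookup_free_part split: if_splits)
  then show ?thesis
    unfolding x degree_part.abs_eq
    by (subst poly_mapping_expand[of "free_part i p"])
       (use assms in \<open>simp add: abs_grassmann_sum abs_grassmann_single_long\<close>)
qed

theorem sum_degree_part:
  fixes x :: "('m::len0, 'r::comm_ring_1) grassmann"
  shows "x = (\<Sum>i\<le>LENGTH('m). degree_part i x)"
proof -
  obtain p where x: "x = abs_grassmann p"
    using abs_grassmann_surj by blast
  obtain N where N: "\<And>w. w \<in> Poly_Mapping.keys p \<Longrightarrow> length (letters w) \<le> N"
  proof
    fix w assume "w \<in> Poly_Mapping.keys p"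
    then show "length (letters w) \<le> (\<Sum>u\<in>Poly_Mapping.keys p. length (letters u))"
      by (intro member_le_sum) simp_all
  qed
  define M where "M = max N (LENGTH('m))"
  have "p = (\<Sum>i\<le>M. free_part i p)"
  proof (rule poly_mapping_eqI)
    fix w
    have "Poly_Mapping.lookup p w = 0" if "\<not> length (letters w) \<le> M"
      using N[of w] that by (cases "Poly_Mapping.lookup p w = 0") (auto simp: M_def in_keys_iff)
    then show "Poly_Mapping.lookup p w = Poly_Mapping.lookup (\<Sum>i\<le>M. free_part i p) w"
      by (auto simp: lookup_sum lookup_free_part)
  qed
  then have "x = (\<Sum>i\<le>M. degree_part i x)"
    unfolding x degree_part.abs_eq abs_grassmann_sum[symmetric] by simp
  also have "\<dots> = (\<Sum>i\<le>LENGTH('m). degree_part i x)"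
    by (rule sum.mono_neutral_right) (auto simp: M_def degree_part_eq_0)
  finally show ?thesis .
qed

theorem degree_part_unique:
  fixes x :: "('m::len0, 'r::comm_ring_1) grassmann"
  assumes "\<And>i. i \<le> LENGTH('m) \<Longrightarrow> c i \<in> graded_piece i" "x = (\<Sum>i\<le>LENGTH('m). c i)"
    and "j \<le> LENGTH('m)"
  shows "c j = degree_part j x"
proof -
  have "degree_part j x = (\<Sum>i\<le>LENGTH('m). if j = i then c i else 0)"
    unfolding assms(2) degree_part_sum
    by (rule sum.cong) (auto simp: degree_part_graded_piece[OF assms(1)])
  then show ?thesis
    using assms(3) by simp
qed

definition eval_mat_poly :: "'r::comm_ring_1 poly \<Rightarrow> ('m::len0, 'r) grassmann mat \<Rightarrow> ('m, 'r) grassmann mat" where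
  "eval_mat_poly f A = mat (dim_row A) (dim_row A)
     (\<lambda>(p, q). \<Sum>k\<le>degree f. scalar (coeff f k) * (A ^\<^sub>m k) $$ (p, q))"

end

theory Submission
  imports Defs
begin

text \<open>
  Write \<open>k = \<lceil>m/2\<rceil>\<close> and let \<open>x\<close> be a central variable. It suffices to show that
  \<open>f\<^sup>k\<^sup>+\<^sup>1 (x - A)\<^sup>-\<^sup>1\<close> has entries that are polynomials in \<open>x\<close>, since then \<open>x - A\<close> divides
  \<open>f\<^sup>k\<^sup>+\<^sup>1\<close> and the remainder theorem applies. Split \<open>A = U + V\<close> into its even and odd part
  and put \<open>R = (x - U)\<^sup>-\<^sup>1\<close>. Then \<open>(x - A)\<^sup>-\<^sup>1 = (1 + R V) (x - U - V R V)\<^sup>-\<^sup>1\<close>, where the last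
  factor inverts a matrix over the commutative ring of even elements. The key fact is
  \<open>det (x - U - V R V) = det (x - U)\<close>, obtained by adding the summands \<open>N v\<^sub>i\<close> of \<open>V\<close> one at a
  time: each changes the determinant by a trace that vanishes because \<open>v\<^sub>i\<close> anticommutes
  with odd elements. As \<open>det (x - U)\<close> is \<open>f\<close> up to nilpotents of degree at least 2, every two
  degrees in the expansion of the resolvent cost only one factor \<open>1/f\<close>.
\<close>

section \<open>Monomials and the grading\<close>

text \<open>Two obstacles shape the argument. Integers need not be invertible in \<open>R\<close>,
  so a determinant cannot be recovered from traces of powers. This is why the generators are added
  one at a time: the entries of each increment have vanishing pairwise products, and the determinant
  is then exactly affine in the increment. Moreover \<open>f\<close> need not be invertible in
  \<open>R[x]\<close>; it is only monic, hence cancellable. Inverses are therefore replaced by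
  adjugates, and degree components are rescaled by powers of \<open>f\<close> so that everything
  stays polynomial. The scaling also turns the determinant of the even matrix into \<open>f\<close>
  times a unit. The degree \<open>d\<close> component of the resolvent ends up with denominator
  \<open>f ^ (1 + (d + 1) div 2)\<close>, and \<open>d\<close> is at most the rank, which gives the
  exponent. The ring \<open>E^m[x]\<close> is realised as the Grassmann algebra over
  \<open>R[x]\<close>, where the variable is central and the whole theory of the grading
  applies.\<close>

abbreviation monomial :: "'m gword \<Rightarrow> 'r \<Rightarrow> ('m::len0, 'r::comm_ring_1) grassmann" where
  "monomial w c \<equiv> abs_grassmann (Poly_Mapping.single w c)"

text \<open>Monomials carry their coefficient, so there is no separate case for scalars, and zero is
  the monomial with coefficient 0.\<close>

lemma grassmann_induct [case_names monomial add]: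
  fixes x :: "('m::len0, 'r::comm_ring_1) grassmann"
  assumes monomial: "\<And>w c. P (monomial w c)"
    and add: "\<And>x y. P x \<Longrightarrow> P y \<Longrightarrow> P (x + y)"
  shows "P x"
proof -
  obtain p where x: "x = abs_grassmann p"
    using abs_grassmann_surj by blast
  have P0: "P 0"
    using monomial[of 0 0] by (simp add: zero_grassmann_def)
  have "P (\<Sum>w\<in>T. monomial w (Poly_Mapping.lookup p w))" if "finite T" for T
    using that by (induction rule: finite_induct) (simp_all add: P0 monomial add)
  then show ?thesis
    unfolding x by (subst poly_mapping_expand) (simp add: abs_grassmann_sum)
qed

lemma monomial_mult: "monomial u c * monomial w d = monomial (u + w) (c * d)"
  by (simp add: times_grassmann.abs_eq mult_single)

lemma monomial_add: "monomial u c + monomial u d = monomial u (c + d)"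
  by (simp add: plus_grassmann.abs_eq single_add)

lemma abs_grassmann_0 [simp]: "abs_grassmann 0 = 0"
  by (simp add: zero_grassmann_def)

lemma scalar_eq_monomial: "scalar c = monomial 0 c"
  by (simp add: scalar.abs_eq)

lemma gen_eq_monomial: "gen k = monomial (Gword [k]) 1"
  by (simp add: gen.abs_eq free_var_def)

lemma scalar_0 [simp]: "scalar 0 = 0"
  and scalar_1 [simp]: "scalar 1 = 1"
  and scalar_add: "scalar (c + d) = scalar c + scalar d"
  and scalar_mult: "scalar (c * d) = scalar c * scalar d"
  by (simp_all add: scalar_eq_monomial monomial_add monomial_mult one_grassmann_def)

lemma scalar_uminus: "scalar (- c) = - scalar c"
  by (metis add.right_inverse add_eq_0_iff scalar_0 scalar_add)

lemma scalar_diff: "scalar (c - d) = scalar c - scalar d"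
  using scalar_add[of c "- d"] by (simp add: scalar_uminus)

lemma scalar_commute: "scalar c * x = x * scalar c"
  by (induction x rule: grassmann_induct)
     (simp_all add: scalar_eq_monomial monomial_mult mult.commute distrib_left distrib_right)

lemma degree_part_monomial:
  "degree_part i (monomial w c) = (if length (letters w) = i then monomial w c else 0)"
  by (simp add: degree_part.abs_eq free_part_single)

lemma degree_part_uminus: "degree_part i (- x) = - degree_part i x"
  by (metis add.right_inverse add_eq_0_iff degree_part_0 degree_part_add)

lemma degree_part_diff: "degree_part i (x - y) = degree_part i x - degree_part i y"
  using degree_part_add[of i x "- y"] by (simp add: degree_part_uminus)

lemma degree_part_mult:
  "degree_part i (x * y) = (\<Sum>a\<le>i. degree_part a x * degree_part (i - a) y)"
proof (induction x rule: grassmann_induct)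
  case (monomial u c)
  show ?case
  proof (induction y rule: grassmann_induct)
    case (monomial w d)
    have "(\<Sum>a\<le>i. degree_part a (monomial u c) * degree_part (i - a) (monomial w d)) =
      (\<Sum>a\<le>i. if a = length (letters u) then
        (if length (letters u) + length (letters w) = i then monomial u c * monomial w d else 0) else 0)"
      by (rule sum.cong) (auto simp: degree_part_monomial)
    then show ?case
      by (auto simp: monomial_mult degree_part_monomial length_letters_add)
  qed (simp add: distrib_left degree_part_add sum.distrib)
qed (simp add: distrib_right degree_part_add sum.distrib)

lemma degree_part_scalar: "degree_part i (scalar c) = (if i = 0 then scalar c else 0)"
proof -
  have "letters (0 :: 'a gword) = []"
    by transfer simp
  then show ?thesis
    by (simp add: scalar_eq_monomial degree_part_monomial)
qed

lemma degree_part_1: "degree_part i 1 = (if i = 0 then 1 else 0)"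
  using degree_part_scalar[of i 1] by (auto split: if_splits)

lemma degree_part_scalar_mult: "degree_part i (scalar c * x) = scalar c * degree_part i x"
proof -
  have "degree_part i (scalar c * x) =
      (\<Sum>a\<le>i. if a = 0 then scalar c * degree_part i x else 0)"
    unfolding degree_part_mult by (rule sum.cong) (auto simp: degree_part_scalar)
  then show ?thesis
    by simp
qed

lemma degree_part_degree_part: "degree_part i (degree_part j x) = (if i = j then degree_part i x else 0)"
  using degree_part_graded_piece[OF degree_part_in_graded_piece[of j x], of i] by auto

lemma grassmann_eqI:
  fixes x y :: "('m::len0, 'r::comm_ring_1) grassmann"
  assumes "\<And>i. i \<le> LENGTH('m) \<Longrightarrow> degree_part i x = degree_part i y"
  shows "x = y"
  by (subst sum_degree_part[of x], subst sum_degree_part[of y]) (simp add: assms)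

text \<open>Moving \<open>gen k\<close> across a word costs one sign per letter. The sum over
  degrees makes this available for inhomogeneous \<open>x\<close>; even and odd elements are the two
  special cases.\<close>

lemma gen_commute:
  fixes x :: "('m::len0, 'r::comm_ring_1) grassmann"
  assumes "k \<in> {1..LENGTH('m)}"
  shows "gen k * x = (\<Sum>i\<le>LENGTH('m). (-1) ^ i * degree_part i x) * gen k"
proof (induction x rule: grassmann_induct)
  case (monomial w c)
  have *: "gen k * prod_list (map gen z) = (-1) ^ length z * prod_list (map gen z) *
      (gen k :: ('m, 'r) grassmann)" if "set z \<subseteq> {1..LENGTH('m)}" for z
    using that
  proof (induction z)
    case (Cons a z)
    have "gen k * prod_list (map gen (a # z)) =
        (gen k * gen a) * (prod_list (map gen z) :: ('m, 'r) grassmann)"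
      by (simp add: mult.assoc)
    also have "gen k * gen a = - (gen a * gen k :: ('m, 'r) grassmann)"
      using Cons.prems assms by (intro gen_anticommute) auto
    also have "- (gen a * gen k) * prod_list (map gen z) =
        - (gen a * (gen k * (prod_list (map gen z) :: ('m, 'r) grassmann)))"
      by (simp add: mult.assoc)
    also have "gen k * prod_list (map gen z) = (-1) ^ length z * prod_list (map gen z) *
      (gen k :: ('m, 'r) grassmann)"
      using Cons by simp
    also have "- (gen a * ((-1) ^ length z * prod_list (map gen z) * gen k)) =
       (-1) ^ length (a # z) * prod_list (map gen (a # z)) * (gen k :: ('m, 'r) grassmann)"
      by (cases "even (length z)") (simp_all add: mult.assoc)
    finally show ?case .
  qed simp
  have w: "set (letters w) \<subseteq> {1..LENGTH('m)}"
    using letters by blast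
  have "gen k * monomial w c = scalar c * (gen k * prod_list (map gen (letters w)))"
    using abs_grassmann_single[OF w, of c] scalar_commute[of c "gen k :: ('m, 'r) grassmann"]
    by (simp add: letters_inverse mult.assoc[symmetric])
  also have "\<dots> = (-1) ^ length (letters w) * monomial w c * gen k"
    using abs_grassmann_single[OF w, of c] unfolding *[OF w]
    by (cases "even (length (letters w))") (simp_all add: letters_inverse mult.assoc)
  \<comment> \<open>A word longer than the rank matches no index of the sum, but its monomial is
    zero.\<close>
  also have "(-1) ^ length (letters w) * monomial w c =
      (\<Sum>i\<le>LENGTH('m). if i = length (letters w) then (-1) ^ i * monomial w c else 0)"
    by (simp add: abs_grassmann_single_long)
  also have "\<dots> = (\<Sum>i\<le>LENGTH('m). (-1) ^ i * degree_part i (monomial w c))"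
    by (rule sum.cong) (auto simp: degree_part_monomial)
  finally show ?case .
qed (simp add: distrib_left distrib_right degree_part_add sum.distrib)

section \<open>Even and odd elements\<close>

definition geven :: "('m::len0, 'r::comm_ring_1) grassmann \<Rightarrow> bool" where
  "geven x \<longleftrightarrow> (\<forall>i. odd i \<longrightarrow> degree_part i x = 0)"

definition godd :: "('m::len0, 'r::comm_ring_1) grassmann \<Rightarrow> bool" where
  "godd x \<longleftrightarrow> (\<forall>i. even i \<longrightarrow> degree_part i x = 0)"

lemma geven_scalar [simp]: "geven (scalar c)"
  and geven_0 [simp]: "geven 0" and geven_1 [simp]: "geven 1"
  by (auto simp: geven_def degree_part_scalar degree_part_1)

lemma geven_add: "geven x \<Longrightarrow> geven y \<Longrightarrow> geven (x + y)"
  and geven_diff: "geven x \<Longrightarrow> geven y \<Longrightarrow> geven (x - y)"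
  and geven_uminus: "geven x \<Longrightarrow> geven (- x)"
  by (simp_all add: geven_def degree_part_add degree_part_diff degree_part_uminus)

lemma geven_sum: "(\<And>t. t \<in> T \<Longrightarrow> geven (g t)) \<Longrightarrow> geven (sum g T)"
  by (simp add: geven_def degree_part_sum)

lemma godd_0 [simp]: "godd 0"
  by (simp add: godd_def)

lemma godd_diff: "godd x \<Longrightarrow> godd y \<Longrightarrow> godd (x - y)"
  by (simp add: godd_def degree_part_diff)

lemma godd_sum: "(\<And>t. t \<in> T \<Longrightarrow> godd (g t)) \<Longrightarrow> godd (sum g T)"
  by (simp add: godd_def degree_part_sum)

lemma geven_mult:
  assumes "geven x" "geven y"
  shows "geven (x * y)"
proof -
  have "degree_part a x * degree_part (i - a) y = 0" if "odd i" "a \<le> i" for a i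
    using that assms by (cases "even a") (auto simp: geven_def)
  then show ?thesis
    by (simp add: geven_def degree_part_mult)
qed

lemma geven_mult_odd:
  assumes "godd x" "godd y"
  shows "geven (x * y)"
proof -
  have "degree_part a x * degree_part (i - a) y = 0" if "odd i" "a \<le> i" for a i
    using that assms by (cases "even a") (auto simp: godd_def)
  then show ?thesis
    by (simp add: geven_def degree_part_mult)
qed

lemma godd_mult_left:
  assumes "godd x" "geven y"
  shows "godd (x * y)"
proof -
  have "degree_part a x * degree_part (i - a) y = 0" if "even i" "a \<le> i" for a i
    using that assms by (cases "even a") (auto simp: geven_def godd_def)
  then show ?thesis
    by (simp add: godd_def degree_part_mult)
qed

lemma godd_mult_right:
  assumes "geven x" "godd y"
  shows "godd (x * y)"
proof -
  have "degree_part a x * degree_part (i - a) y = 0" if "even i" "a \<le> i" for a i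
    using that assms by (cases "even a") (auto simp: geven_def godd_def)
  then show ?thesis
    by (simp add: godd_def degree_part_mult)
qed

lemma godd_gen [simp]:
  assumes "k \<in> {1..LENGTH('m)}"
  shows "godd (gen k :: ('m::len0, 'r::comm_ring_1) grassmann)"
  using assms by (auto simp: godd_def gen_eq_monomial degree_part_monomial)

lemma gen_commute_even:
  fixes x :: "('m::len0, 'r::comm_ring_1) grassmann"
  assumes "k \<in> {1..LENGTH('m)}" "geven x"
  shows "gen k * x = x * gen k"
proof -
  have "(\<Sum>i\<le>LENGTH('m). (-1) ^ i * degree_part i x) = (\<Sum>i\<le>LENGTH('m). degree_part i x)"
    using assms(2) by (intro sum.cong refl) (simp add: geven_def uminus_power_if)
  then show ?thesis
    using gen_commute[OF assms(1), of x] sum_degree_part[of x] by simp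
qed

lemma gen_commute_odd:
  fixes x :: "('m::len0, 'r::comm_ring_1) grassmann"
  assumes "k \<in> {1..LENGTH('m)}" "godd x"
  shows "gen k * x = - (x * gen k)"
proof -
  have "(\<Sum>i\<le>LENGTH('m). (-1) ^ i * degree_part i x) = (\<Sum>i\<le>LENGTH('m). - degree_part i x)"
    using assms(2) by (intro sum.cong refl) (auto simp: godd_def uminus_power_if)
  then show ?thesis
    using gen_commute[OF assms(1), of x] sum_degree_part[of x] by (simp add: sum_negf)
qed

text \<open>Scalars are central and every generator commutes with an even element, so
  \<open>x\<close> passes through any word letter by letter.\<close>

lemma geven_commute:
  fixes x y :: "('m::len0, 'r::comm_ring_1) grassmann"
  assumes "geven x"
  shows "x * y = y * x"
proof (induction y rule: grassmann_induct)
  case (monomial w c)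
  have *: "x * prod_list (map gen z) = prod_list (map gen z) * x" if "set z \<subseteq> {1..LENGTH('m)}" for z
    using that
  proof (induction z)
    case (Cons k z)
    then have "gen k * x = x * gen k"
      using assms by (intro gen_commute_even) auto
    then have "x * (gen k * prod_list (map gen z)) = gen k * (x * prod_list (map gen z))"
      by (simp flip: mult.assoc)
    with Cons show ?case
      by (simp add: mult.assoc)
  qed simp
  have w: "set (letters w) \<subseteq> {1..LENGTH('m)}"
    using letters by blast
  have "x * monomial w c = x * scalar c * prod_list (map gen (letters w))"
    using abs_grassmann_single[OF w, of c] by (simp add: letters_inverse mult.assoc)
  also have "\<dots> = scalar c * (x * prod_list (map gen (letters w)))"
    by (simp add: scalar_commute[of c x] mult.assoc[symmetric])
  also have "\<dots> = monomial w c * x"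
    using abs_grassmann_single[OF w, of c] by (simp add: *[OF w] letters_inverse mult.assoc)
  finally show ?case .
qed (simp add: distrib_left distrib_right)

text \<open>Splitting off the last letter of a word of odd length leaves a word of even length as
  coefficient. This yields the summands from which an odd matrix is built up, one generator at a
  time.\<close>

lemma godd_gens:
  fixes x :: "('m::len0, 'r::comm_ring_1) grassmann"
  assumes "godd x"
  obtains c where "\<And>i. geven (c i)" "x = (\<Sum>i\<in>{1..LENGTH('m)}. c i * gen i)"
proof -
  have "\<exists>c y. (\<forall>i. geven (c i)) \<and> geven y \<and> x = (\<Sum>i\<in>{1..LENGTH('m)}. c i * gen i) + y"
    for x :: "('m, 'r) grassmann"
  proof (induction x rule: grassmann_induct)
    case (monomial w a)
    show ?case
    proof (cases "even (length (letters w))")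
      case True
      then have "geven (monomial w a)"
        by (auto simp: geven_def degree_part_monomial)
      then show ?thesis
        by (intro exI[of _ "\<lambda>_. 0"] exI[of _ "monomial w a"]) simp
    next
      case False
      then obtain z k where z: "letters w = z @ [k]"
        by (cases "letters w" rule: rev_cases) auto
      have w: "set (z @ [k]) \<subseteq> {1..LENGTH('m)}"
        using letters[of w] by (simp flip: z)
      define u :: "'m gword" where "u = Gword z"
      have u: "letters u = z"
        using w unfolding u_def by (subst Gword_inverse) auto
      have k: "k \<in> {1..LENGTH('m)}"
        using w by simp
      have "letters (u + Gword [k]) = letters w"
        using k by (simp add: plus_gword.rep_eq u z)
      then have "w = u + Gword [k]"
        by (simp add: letters_inject)
      then have eq: "monomial w a = monomial u a * gen k"
        by (simp add: gen_eq_monomial monomial_mult)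
      have "geven (monomial u a)"
        using False by (auto simp: geven_def degree_part_monomial u z)
      moreover have "(\<Sum>i\<in>{1..LENGTH('m)}. (if i = k then monomial u a else 0) * gen i) =
          (\<Sum>i\<in>{1..LENGTH('m)}. if i = k then monomial u a * gen k else 0)"
        by (rule sum.cong) auto
      ultimately show ?thesis
        using k by (intro exI[of _ "\<lambda>i. if i = k then monomial u a else 0"] exI[of _ 0])
          (simp add: eq)
    qed
  next
    case (add x x')
    then obtain c y c' y' where
      "\<forall>i. geven (c i)" "geven y" "x = (\<Sum>i\<in>{1..LENGTH('m)}. c i * gen i) + y"
      "\<forall>i. geven (c' i)" "geven y'" "x' = (\<Sum>i\<in>{1..LENGTH('m)}. c' i * gen i) + y'"
      by blast
    then show ?case
      by (intro exI[of _ "\<lambda>i. c i + c' i"] exI[of _ "y + y'"])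
         (simp add: geven_add distrib_right sum.distrib)
  qed
  then obtain c y where c: "\<And>i. geven (c i)" and y: "geven y"
    and x: "x = (\<Sum>i\<in>{1..LENGTH('m)}. c i * gen i) + y"
    by blast
  have odd: "godd (\<Sum>i\<in>{1..LENGTH('m)}. c i * gen i)"
    by (intro godd_sum godd_mult_right c godd_gen)
  have "y = 0"
  proof (rule grassmann_eqI)
    fix i
    have "degree_part i x = degree_part i (\<Sum>i\<in>{1..LENGTH('m)}. c i * gen i) + degree_part i y"
      by (simp add: x degree_part_add)
    then show "degree_part i y = degree_part i 0"
      using assms odd y by (cases "even i") (simp_all add: geven_def godd_def)
  qed
  with that[of c] c x show thesis
    by simp
qed

section \<open>The commutative ring of even elements\<close>

text \<open>A separate type of class \<open>comm_ring_1\<close> makes \<open>det\<close>,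
  \<open>adj_mat\<close> and their laws usable for matrices with even entries.\<close>

typedef (overloaded) ('m, 'r) even_grassmann = "{x :: ('m::len0, 'r::comm_ring_1) grassmann. geven x}"
  morphisms of_even to_even
  by (rule exI[of _ 0]) simp

setup_lifting type_definition_even_grassmann

instantiation even_grassmann :: (len0, comm_ring_1) comm_ring_1
begin

lift_definition zero_even_grassmann :: "('a, 'b) even_grassmann" is 0 by simp
lift_definition one_even_grassmann :: "('a, 'b) even_grassmann" is 1 by simp
lift_definition plus_even_grassmann ::
  "('a, 'b) even_grassmann \<Rightarrow> ('a, 'b) even_grassmann \<Rightarrow> ('a, 'b) even_grassmann" is "(+)"
  by (rule geven_add)
lift_definition minus_even_grassmann ::
  "('a, 'b) even_grassmann \<Rightarrow> ('a, 'b) even_grassmann \<Rightarrow> ('a, 'b) even_grassmann" is "(-)"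
  by (rule geven_diff)
lift_definition uminus_even_grassmann ::
  "('a, 'b) even_grassmann \<Rightarrow> ('a, 'b) even_grassmann" is uminus
  by (rule geven_uminus)
lift_definition times_even_grassmann ::
  "('a, 'b) even_grassmann \<Rightarrow> ('a, 'b) even_grassmann \<Rightarrow> ('a, 'b) even_grassmann" is "(*)"
  by (rule geven_mult)

instance
  by standard (transfer, simp add: algebra_simps geven_commute)+

end

lemma of_even_hom: "inj_ring_hom of_even"
  by unfold_locales
     (simp_all add: zero_even_grassmann.rep_eq one_even_grassmann.rep_eq
       plus_even_grassmann.rep_eq times_even_grassmann.rep_eq flip: of_even_inject)

interpretation of_even: inj_ring_hom of_even
  by (rule of_even_hom)

lemma geven_of_even [simp]: "geven (of_even x)"
  using of_even[of x] by simp

lemma of_even_to_even: "geven x \<Longrightarrow> of_even (to_even x) = x"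
  by (simp add: to_even_inverse)

lemma to_even_hom:
  "geven x \<Longrightarrow> geven y \<Longrightarrow> to_even (x + y) = to_even x + to_even y"
  "geven x \<Longrightarrow> geven y \<Longrightarrow> to_even (x - y) = to_even x - to_even y"
  "geven x \<Longrightarrow> geven y \<Longrightarrow> to_even (x * y) = to_even x * to_even y"
  by (simp_all add: to_even_inverse geven_add geven_diff geven_mult of_even.hom_add
      of_even.hom_minus of_even.hom_mult flip: of_even_inject)

subsection \<open>Determinants\<close>

text \<open>In the Leibniz formula each difference of products telescopes into multiples of
  differences of entries. It is used with \<open>I\<close> an annihilator, and with \<open>I\<close>
  the multiples of \<open>f\<close> by even elements of positive degree.\<close>

lemma det_diff_in_ideal:
  fixes M N :: "'a::comm_ring_1 mat"
  assumes M: "M \<in> carrier_mat n n" and N: "N \<in> carrier_mat n n"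
    and I0: "0 \<in> I" and I_add: "\<And>x y. x \<in> I \<Longrightarrow> y \<in> I \<Longrightarrow> x + y \<in> I"
    and I_mult: "\<And>x y. x \<in> I \<Longrightarrow> y * x \<in> I"
    and MN: "\<And>i j. i < n \<Longrightarrow> j < n \<Longrightarrow> M $$ (i, j) - N $$ (i, j) \<in> I"
  shows "det M - det N \<in> I"
proof -
  have prod: "(\<Prod>i\<in>T. M $$ (i, p i)) - (\<Prod>i\<in>T. N $$ (i, p i)) \<in> I"
    if "finite T" "T \<subseteq> {0..<n}" "p permutes {0..<n}" for T p
    using that
  proof (induction rule: finite_induct)
    case (insert i T)
    define a b where "a = (\<Prod>i\<in>T. M $$ (i, p i))" and "b = (\<Prod>i\<in>T. N $$ (i, p i))"
    have "p i < n"
      using insert.prems permutes_in_image[of p "{0..<n}" i] by simp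
    then have "M $$ (i, p i) - N $$ (i, p i) \<in> I" "a - b \<in> I"
      using insert by (simp_all add: MN a_def b_def)
    then have "M $$ (i, p i) * (a - b) + b * (M $$ (i, p i) - N $$ (i, p i)) \<in> I"
      by (intro I_add I_mult)
    then show ?case
      using insert.hyps by (simp add: algebra_simps a_def b_def)
  qed (simp add: I0)
  have sum: "sum g T \<in> I" if "\<And>t. t \<in> T \<Longrightarrow> g t \<in> I" for g :: "(nat \<Rightarrow> nat) \<Rightarrow> 'a" and T
    using that by (induction T rule: infinite_finite_induct) (simp_all add: I0 I_add)
  have "det M - det N = (\<Sum>p | p permutes {0..<n}. signof p *
      ((\<Prod>i = 0..<n. M $$ (i, p i)) - (\<Prod>i = 0..<n. N $$ (i, p i))))"
    unfolding det_def'[OF M] det_def'[OF N] by (simp add: sum_subtractf right_diff_distrib)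
  also have "\<dots> \<in> I"
    by (intro sum I_mult prod) auto
  finally show ?thesis .
qed

definition mat_trace :: "'a::comm_monoid_add mat \<Rightarrow> 'a" where
  "mat_trace M = (\<Sum>i<dim_row M. M $$ (i, i))"

text \<open>The first order expansion of the determinant is exact here: every term that contains two
  entries of \<open>Y\<close> vanishes. No division is involved.\<close>

lemma det_add_square_zero:
  fixes X Y :: "'a::comm_ring_1 mat"
  assumes X: "X \<in> carrier_mat n n" and Y: "Y \<in> carrier_mat n n"
    and Y2: "\<And>i j k l. i < n \<Longrightarrow> j < n \<Longrightarrow> k < n \<Longrightarrow> l < n \<Longrightarrow> Y $$ (i, j) * Y $$ (k, l) = 0"
  shows "det (X + Y) = det X + mat_trace (adj_mat X * Y)"
proof -
  \<comment> \<open>\<open>Y\<close> is added row by row: \<open>Z r\<close> has it in the first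
    \<open>r\<close> rows, and Laplace expansion along row \<open>r\<close> compares
    \<open>Z r\<close> with \<open>Z (Suc r)\<close>.\<close>
  define Z where "Z r = mat n n (\<lambda>(i, j). X $$ (i, j) + (if i < r then Y $$ (i, j) else 0))" for r
  \<comment> \<open>The annihilator of the entries of \<open>Y\<close>. Minors of \<open>Z r\<close>
    and of \<open>X\<close> agree modulo entries of \<open>Y\<close>, which lie in \<open>I\<close>,
    so they become equal once multiplied by a further entry of \<open>Y\<close>.\<close>
  define I where "I = {z. \<forall>i<n. \<forall>j<n. Y $$ (i, j) * z = 0}"
  have Z: "Z r \<in> carrier_mat n n" for r
    by (simp add: Z_def)
  have step: "det (Z r) = det X + (\<Sum>i<r. \<Sum>j<n. Y $$ (i, j) * cofactor X i j)" if "r \<le> n" for r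
    using that
  proof (induction r)
    case 0
    have "Z 0 = X"
      using X by (intro eq_matI) (auto simp: Z_def)
    then show ?case by simp
  next
    case (Suc r)
    then have r: "r < n" by simp
    have cof: "cofactor (Z (Suc r)) r j = cofactor (Z r) r j" if "j < n" for j
    proof -
      have "mat_delete (Z (Suc r)) r j = mat_delete (Z r) r j"
        unfolding mat_delete_def by (intro eq_matI) (auto simp: Z_def less_Suc_eq)
      then show ?thesis
        by (simp add: cofactor_def)
    qed
    have Ycof: "Y $$ (r, j) * cofactor (Z r) r j = Y $$ (r, j) * cofactor X r j" if j: "j < n" for j
    proof -
      have "det (mat_delete (Z r) r j) - det (mat_delete X r j) \<in> I"
      proof (rule det_diff_in_ideal)
        show "mat_delete (Z r) r j \<in> carrier_mat (n - 1) (n - 1)"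
          "mat_delete X r j \<in> carrier_mat (n - 1) (n - 1)"
          using mat_delete_carrier[OF Z[of r]] mat_delete_carrier[OF X] by auto
        fix a b assume ab: "a < n - 1" "b < n - 1"
        let ?a = "if a < r then a else Suc a" and ?b = "if b < j then b else Suc b"
        have "mat_delete (Z r) r j $$ (a, b) - mat_delete X r j $$ (a, b) =
          (if ?a < r then Y $$ (?a, ?b) else 0)"
          using ab X by (simp add: mat_delete_def Z_def)
        moreover have "?a < n" "?b < n"
          using ab by auto
        ultimately show "mat_delete (Z r) r j $$ (a, b) - mat_delete X r j $$ (a, b) \<in> I"
          using Y2 by (simp add: I_def)
      qed (auto simp: I_def distrib_left mult.left_commute)
      then have "Y $$ (r, j) * det (mat_delete (Z r) r j) = Y $$ (r, j) * det (mat_delete X r j)"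
        using r j by (simp add: I_def right_diff_distrib)
      then show ?thesis
        unfolding cofactor_def by (metis mult.left_commute)
    qed
    have "det (Z (Suc r)) = (\<Sum>j<n. Z (Suc r) $$ (r, j) * cofactor (Z (Suc r)) r j)"
      by (rule laplace_expansion_row[OF Z r])
    also have "\<dots> = (\<Sum>j<n. Z r $$ (r, j) * cofactor (Z r) r j + Y $$ (r, j) * cofactor X r j)"
    proof (rule sum.cong)
      fix j assume "j \<in> {..<n}"
      then have j: "j < n" by simp
      have "Z (Suc r) $$ (r, j) = Z r $$ (r, j) + Y $$ (r, j)"
        using r j by (simp add: Z_def)
      then show "Z (Suc r) $$ (r, j) * cofactor (Z (Suc r)) r j =
          Z r $$ (r, j) * cofactor (Z r) r j + Y $$ (r, j) * cofactor X r j"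
        by (simp only: cof[OF j] Ycof[OF j, symmetric] distrib_right)
    qed simp
    also have "\<dots> = det (Z r) + (\<Sum>j<n. Y $$ (r, j) * cofactor X r j)"
      by (simp add: sum.distrib laplace_expansion_row[OF Z r])
    finally show ?case
      using Suc by simp
  qed
  have "Z n = X + Y"
    using X Y by (intro eq_matI) (auto simp: Z_def)
  then have "det (X + Y) = det X + (\<Sum>i<n. \<Sum>j<n. Y $$ (i, j) * cofactor X i j)"
    using step[of n] by simp
  also have "(\<Sum>i<n. \<Sum>j<n. Y $$ (i, j) * cofactor X i j) = mat_trace (adj_mat X * Y)"
    using X Y by (subst sum.swap)
      (auto simp: mat_trace_def adj_mat_def scalar_prod_def mult.commute atLeast0LessThan intro!: sum.cong)
  finally show ?thesis .
qed

subsection \<open>Matrices with even entries\<close>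

definition even_mats :: "nat \<Rightarrow> ('m::len0, 'r::comm_ring_1) grassmann mat set" where
  "even_mats n = {M \<in> carrier_mat n n. \<forall>i<n. \<forall>j<n. geven (M $$ (i, j))}"

definition odd_mats :: "nat \<Rightarrow> ('m::len0, 'r::comm_ring_1) grassmann mat set" where
  "odd_mats n = {M \<in> carrier_mat n n. \<forall>i<n. \<forall>j<n. godd (M $$ (i, j))}"

lemma even_mats_carrier: "M \<in> even_mats n \<Longrightarrow> M \<in> carrier_mat n n"
  and odd_mats_carrier: "M \<in> odd_mats n \<Longrightarrow> M \<in> carrier_mat n n"
  by (simp_all add: even_mats_def odd_mats_def)

lemma even_matsD:
  assumes "M \<in> even_mats n"
  shows "dim_row M = n" "dim_col M = n" "i < n \<Longrightarrow> j < n \<Longrightarrow> geven (M $$ (i, j))"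
  using assms by (auto simp: even_mats_def)

lemma odd_matsD:
  assumes "M \<in> odd_mats n"
  shows "dim_row M = n" "dim_col M = n" "i < n \<Longrightarrow> j < n \<Longrightarrow> godd (M $$ (i, j))"
  using assms by (auto simp: odd_mats_def)

lemma even_matsI:
  assumes "dim_row M = n" "dim_col M = n" "\<And>i j. i < n \<Longrightarrow> j < n \<Longrightarrow> geven (M $$ (i, j))"
  shows "M \<in> even_mats n"
  using assms by (auto simp: even_mats_def)

lemma odd_matsI:
  assumes "dim_row M = n" "dim_col M = n" "\<And>i j. i < n \<Longrightarrow> j < n \<Longrightarrow> godd (M $$ (i, j))"
  shows "M \<in> odd_mats n"
  using assms by (auto simp: odd_mats_def)

lemma even_mats_mult: "M \<in> even_mats n \<Longrightarrow> N \<in> even_mats n \<Longrightarrow> M * N \<in> even_mats n"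
  and even_mats_mult_odd: "M \<in> odd_mats n \<Longrightarrow> N \<in> odd_mats n \<Longrightarrow> M * N \<in> even_mats n"
  and odd_mats_mult_left: "M \<in> odd_mats n \<Longrightarrow> N \<in> even_mats n \<Longrightarrow> M * N \<in> odd_mats n"
  and odd_mats_mult_right: "M \<in> even_mats n \<Longrightarrow> N \<in> odd_mats n \<Longrightarrow> M * N \<in> odd_mats n"
  by (auto simp: even_matsD odd_matsD scalar_prod_def
      intro!: even_matsI odd_matsI geven_sum godd_sum)
     (auto simp: even_matsD odd_matsD
      intro: geven_mult geven_mult_odd godd_mult_left godd_mult_right)

lemma even_mats_diff: "M \<in> even_mats n \<Longrightarrow> N \<in> even_mats n \<Longrightarrow> M - N \<in> even_mats n"
  and odd_mats_diff: "M \<in> odd_mats n \<Longrightarrow> N \<in> odd_mats n \<Longrightarrow> M - N \<in> odd_mats n"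
  by (auto simp: even_mats_def odd_mats_def intro!: geven_diff godd_diff)

lemma even_mats_smult_one: "geven c \<Longrightarrow> c \<cdot>\<^sub>m 1\<^sub>m n \<in> even_mats n"
  by (simp add: even_mats_def one_mat_def geven_mult)

lemma even_mats_smult: "geven c \<Longrightarrow> M \<in> even_mats n \<Longrightarrow> c \<cdot>\<^sub>m M \<in> even_mats n"
  by (auto simp: even_matsD intro!: even_matsI geven_mult)

lemma of_even_mat: "M \<in> even_mats n \<Longrightarrow> map_mat of_even (map_mat to_even M) = M"
  by (intro eq_matI) (auto simp: even_mats_def of_even_to_even)

lemma even_mats_of_even: "M \<in> carrier_mat n n \<Longrightarrow> map_mat of_even M \<in> even_mats n"
  by (simp add: even_mats_def)

text \<open>Meaningful for matrices in \<open>even_mats\<close> only, since \<open>to_even\<close>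
  is unspecified elsewhere. The value is sent back to the full algebra so that it can be multiplied
  with odd matrices.\<close>

definition even_det :: "('m::len0, 'r::comm_ring_1) grassmann mat \<Rightarrow> ('m, 'r) grassmann" where
  "even_det M = of_even (det (map_mat to_even M))"

definition even_adj :: "('m::len0, 'r::comm_ring_1) grassmann mat \<Rightarrow> ('m, 'r) grassmann mat" where
  "even_adj M = map_mat of_even (adj_mat (map_mat to_even M))"

lemma geven_even_det [simp]: "geven (even_det M)"
  by (simp add: even_det_def)

lemma even_adj:
  fixes M :: "('m::len0, 'r::comm_ring_1) grassmann mat"
  assumes M: "M \<in> even_mats n"
  shows "even_adj M \<in> even_mats n"
    and "M * even_adj M = even_det M \<cdot>\<^sub>m 1\<^sub>m n"
    and "even_adj M * M = even_det M \<cdot>\<^sub>m 1\<^sub>m n"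
proof -
  let ?M = "map_mat to_even M :: ('m, 'r) even_grassmann mat"
  have M': "?M \<in> carrier_mat n n"
    using even_mats_carrier[OF M] by simp
  note adj = adj_mat[OF M']
  show "even_adj M \<in> even_mats n"
    using adj(1) by (simp add: even_adj_def even_mats_of_even)
  have one: "map_mat of_even (c \<cdot>\<^sub>m 1\<^sub>m n) = of_even c \<cdot>\<^sub>m 1\<^sub>m n" for c :: "('m, 'r) even_grassmann"
    by (intro eq_matI) (auto simp: of_even.hom_mult)
  show "M * even_adj M = even_det M \<cdot>\<^sub>m 1\<^sub>m n"
    using of_even.mat_hom_mult[OF M' adj(1)]
    by (simp add: even_adj_def even_det_def of_even_mat[OF M] adj(2) one)
  show "even_adj M * M = even_det M \<cdot>\<^sub>m 1\<^sub>m n"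
    using of_even.mat_hom_mult[OF adj(1) M']
    by (simp add: even_adj_def even_det_def of_even_mat[OF M] adj(3) one)
qed

lemma even_det_diff_in_ideal:
  assumes M: "M \<in> even_mats n" and N: "N \<in> even_mats n"
    and I: "0 \<in> I" "\<And>x y. x \<in> I \<Longrightarrow> y \<in> I \<Longrightarrow> x + y \<in> I" "\<And>x y. geven y \<Longrightarrow> x \<in> I \<Longrightarrow> y * x \<in> I"
    and MN: "\<And>i j. i < n \<Longrightarrow> j < n \<Longrightarrow> M $$ (i, j) - N $$ (i, j) \<in> I"
  shows "even_det M - even_det N \<in> I"
proof -
  have "det (map_mat to_even M) - det (map_mat to_even N) \<in> {x. of_even x \<in> I}"
  proof (rule det_diff_in_ideal)
    show "map_mat to_even M \<in> carrier_mat n n" "map_mat to_even N \<in> carrier_mat n n"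
      using even_mats_carrier[OF M] even_mats_carrier[OF N] by simp_all
    fix i j assume "i < n" "j < n"
    then show "map_mat to_even M $$ (i, j) - map_mat to_even N $$ (i, j) \<in> {x. of_even x \<in> I}"
      using M N MN[of i j] by (simp add: even_matsD of_even.hom_minus of_even_to_even)
  qed (simp_all add: I of_even.hom_add of_even.hom_mult)
  then show ?thesis
    by (simp add: even_det_def of_even.hom_minus)
qed

lemma even_det_add_square_zero:
  fixes X :: "('m::len0, 'r::comm_ring_1) grassmann mat"
  assumes X: "X \<in> even_mats n" and Y: "Y \<in> even_mats n"
    and Y2: "\<And>i j k l. i < n \<Longrightarrow> j < n \<Longrightarrow> k < n \<Longrightarrow> l < n \<Longrightarrow> Y $$ (i, j) * Y $$ (k, l) = 0"
  shows "even_det (X + Y) = even_det X + mat_trace (even_adj X * Y)"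
proof -
  let ?X = "map_mat to_even X :: ('m, 'r) even_grassmann mat"
  let ?Y = "map_mat to_even Y :: ('m, 'r) even_grassmann mat"
  have X': "?X \<in> carrier_mat n n" and Y': "?Y \<in> carrier_mat n n"
    using even_mats_carrier[OF X] even_mats_carrier[OF Y] by simp_all
  have sq: "?Y $$ (i, j) * ?Y $$ (k, l) = 0" if "i < n" "j < n" "k < n" "l < n" for i j k l
    using Y Y2 that by (simp add: even_matsD to_even_hom(3)[symmetric] zero_even_grassmann_def)
  have "map_mat to_even (X + Y) = ?X + ?Y"
    using X Y by (intro eq_matI) (auto simp: even_mats_def to_even_hom)
  then have "even_det (X + Y) = even_det X + of_even (mat_trace (adj_mat ?X * ?Y))"
    using det_add_square_zero[OF X' Y' sq] by (simp add: even_det_def of_even.hom_add)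
  also have "of_even (mat_trace (adj_mat ?X * ?Y)) = mat_trace (map_mat of_even (adj_mat ?X * ?Y))"
    using adj_mat(1)[OF X'] Y' by (simp add: mat_trace_def of_even.hom_sum)
  also have "\<dots> = mat_trace (even_adj X * Y)"
    using of_even.mat_hom_mult[OF adj_mat(1)[OF X'] Y'] of_even_mat[OF Y] by (simp add: even_adj_def)
  finally show ?thesis .
qed

section \<open>Determinants and odd perturbations\<close>

lemma smult_one_mult: "M \<in> carrier_mat n n \<Longrightarrow> (c \<cdot>\<^sub>m 1\<^sub>m n) * M = c \<cdot>\<^sub>m (M :: 'a::ring_1 mat)"
  by (intro eq_matI) (auto simp: scalar_prod_def if_distrib[of "\<lambda>x. c * x * _"] cong: if_cong)

lemma mult_smult_one:
  fixes M :: "('m::len0, 'r::comm_ring_1) grassmann mat"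
  assumes "M \<in> carrier_mat n n" "geven c"
  shows "M * (c \<cdot>\<^sub>m 1\<^sub>m n) = c \<cdot>\<^sub>m M"
  using assms
  by (intro eq_matI) (auto simp: scalar_prod_def geven_commute[of c]
      if_distrib[of "\<lambda>x. _ * (x * c)"] cong: if_cong)

lemma mult_even_smult:
  fixes M :: "('m::len0, 'r::comm_ring_1) grassmann mat"
  assumes "M \<in> carrier_mat n n" "N \<in> carrier_mat n n" "geven c"
  shows "M * (c \<cdot>\<^sub>m N) = c \<cdot>\<^sub>m (M * N)" "(c \<cdot>\<^sub>m M) * N = c \<cdot>\<^sub>m (M * N)"
proof -
  have "x * (c * y) = c * (x * y)" for x y
    using geven_commute[OF assms(3), of x] by (simp flip: mult.assoc)
  with assms show "M * (c \<cdot>\<^sub>m N) = c \<cdot>\<^sub>m (M * N)"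
    by (intro eq_matI) (auto simp: scalar_prod_def sum_distrib_left)
  show "(c \<cdot>\<^sub>m M) * N = c \<cdot>\<^sub>m (M * N)"
    using assms by (intro eq_matI) (auto simp: scalar_prod_def sum_distrib_left mult.assoc)
qed

text \<open>Between odd matrices the trace is cyclic only up to sign; one factor with even, hence
  central, entries restores cyclicity.\<close>

lemma mat_trace_even_commute:
  assumes X: "X \<in> even_mats n" and W: "W \<in> carrier_mat n n"
  shows "mat_trace (X * W) = mat_trace (W * X)"
proof -
  have "mat_trace (X * W) = (\<Sum>i<n. \<Sum>j<n. X $$ (i, j) * W $$ (j, i))"
    using even_mats_carrier[OF X] W by (auto simp: mat_trace_def scalar_prod_def atLeast0LessThan)
  also have "\<dots> = (\<Sum>j<n. \<Sum>i<n. W $$ (j, i) * X $$ (i, j))"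
    by (subst sum.swap) (auto intro!: sum.cong geven_commute even_matsD(3)[OF X])
  also have "\<dots> = mat_trace (W * X)"
    using even_mats_carrier[OF X] W by (auto simp: mat_trace_def scalar_prod_def atLeast0LessThan)
  finally show ?thesis .
qed

lemma mat_trace_diff:
  "M \<in> carrier_mat n n \<Longrightarrow> N \<in> carrier_mat n n \<Longrightarrow>
    mat_trace (M - N) = mat_trace M - (mat_trace N :: 'a::ab_group_add)"
  by (auto simp: mat_trace_def sum_subtractf)

text \<open>As a scalar matrix, a generator commutes or anticommutes with whole matrices, and
  multiplying by it from the right multiplies each entry from the right.\<close>

abbreviation gen_mat :: "nat \<Rightarrow> nat \<Rightarrow> ('m::len0, 'r::comm_ring_1) grassmann mat" where
  "gen_mat n k \<equiv> gen k \<cdot>\<^sub>m 1\<^sub>m n"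

lemma mult_gen_mat_index:
  "M \<in> carrier_mat n n \<Longrightarrow> i < n \<Longrightarrow> j < n \<Longrightarrow>
    (M * gen_mat n k) $$ (i, j) = M $$ (i, j) * gen k"
  by (auto simp: scalar_prod_def if_distrib[of "\<lambda>x. _ * (_ * x)"] cong: if_cong)

lemma gen_mat_commute_even:
  fixes M :: "('m::len0, 'r::comm_ring_1) grassmann mat"
  assumes "k \<in> {1..LENGTH('m)}" "M \<in> even_mats n"
  shows "gen_mat n k * M = M * gen_mat n k"
  using even_mats_carrier[OF assms(2)]
  by (intro eq_matI) (auto simp del: index_mult_mat(1)
      simp: smult_one_mult mult_gen_mat_index gen_commute_even[OF assms(1)] even_matsD(3)[OF assms(2)])

lemma gen_mat_commute_odd:
  fixes M :: "('m::len0, 'r::comm_ring_1) grassmann mat"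
  assumes "k \<in> {1..LENGTH('m)}" "M \<in> odd_mats n"
  shows "gen_mat n k * M = - (M * gen_mat n k)"
  using odd_mats_carrier[OF assms(2)]
  by (intro eq_matI) (auto simp del: index_mult_mat(1)
      simp: smult_one_mult mult_gen_mat_index gen_commute_odd[OF assms(1)] odd_matsD(3)[OF assms(2)])

lemma gen_mat_square:
  assumes "k \<in> {1..LENGTH('m)}"
  shows "gen_mat n k * gen_mat n k = (0\<^sub>m n n :: ('m::len0, 'r::comm_ring_1) grassmann mat)"
  using gen_square[OF assms]
  by (intro eq_matI) (auto simp del: index_mult_mat(1) simp: smult_one_mult)

lemma gen_mat_odd:
  assumes "k \<in> {1..LENGTH('m)}"
  shows "(gen_mat n k :: ('m::len0, 'r::comm_ring_1) grassmann mat) \<in> odd_mats n"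
  using assms by (auto intro!: odd_matsI simp: one_mat_def)

text \<open>Moving the first \<open>gen k\<close> across \<open>y\<close> brings the two copies
  together. This supplies the hypothesis on products of entries in
  \<open>even_det_add_square_zero\<close>.\<close>

lemma odd_mult_gen_product:
  fixes x y :: "('m::len0, 'r::comm_ring_1) grassmann"
  assumes "k \<in> {1..LENGTH('m)}" "godd y"
  shows "(x * gen k) * (y * gen k) = 0"
proof -
  have "(x * gen k) * (y * gen k) = x * (gen k * y) * gen k"
    by (simp add: mult.assoc)
  also have "gen k * y = - (y * gen k)"
    by (rule gen_commute_odd[OF assms])
  finally show ?thesis
    using gen_square[OF assms(1), where ?'r = 'r] by (simp add: mult.assoc)
qed

text \<open>
  \<open>P\<close> and \<open>\<Psi>\<close> are inverse up to the factor \<open>c\<close>, so that \<open>V * \<Psi> * V\<close> plays the role of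
  \<open>c V P\<^sup>-\<^sup>1 V\<close> without any division.
\<close>

locale odd_perturbation =
  fixes n :: nat and P \<Psi> :: "('m::len0, 'r::comm_ring_1) grassmann mat" and c
  assumes P: "P \<in> even_mats n" and \<Psi>: "\<Psi> \<in> even_mats n" and c: "geven c"
    and P\<Psi>: "P * \<Psi> = c \<cdot>\<^sub>m 1\<^sub>m n" and \<Psi>P: "\<Psi> * P = c \<cdot>\<^sub>m 1\<^sub>m n"
    and cancel: "\<And>a. even_det P * a = 0 \<Longrightarrow> a = 0"
begin

lemmas assoc = assoc_mult_mat[of _ n n _ n _ n]
lemmas distribs = add_mult_distrib_mat[of _ n n _ _ n] mult_add_distrib_mat[of _ n n _ n]
  minus_mult_distrib_mat[of _ n n _ _ n] mult_minus_distrib_mat[of _ n n _ n]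
lemmas carr = even_mats_carrier odd_mats_carrier mult_carrier_mat[of _ n n _ n]

text \<open>A push-through identity: \<open>P - W * \<Psi> * W\<close> turns
  \<open>\<Psi> * W\<close> on its right into \<open>W * \<Psi>\<close> on its left, because
  \<open>P * \<Psi>\<close> and \<open>\<Psi> * P\<close> are the same central scalar matrix.
  Multiplying by the adjugate \<open>H\<close> on both sides transfers this to \<open>H\<close>, up
  to a factor \<open>even_det P\<close>, which \<open>cancel\<close> removes.\<close>

lemma adj_commute:
  assumes W: "W \<in> odd_mats n" and det: "even_det (P - W * \<Psi> * W) = even_det P"
  defines "H \<equiv> even_adj (P - W * \<Psi> * W)"
  shows "H * (W * \<Psi>) = \<Psi> * W * H"
proof -
  define Z where "Z = P - W * \<Psi> * W"
  have Z: "Z \<in> even_mats n"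
    unfolding Z_def by (intro even_mats_diff P even_mats_mult_odd odd_mats_mult_left W \<Psi>)
  note H = even_adj[OF Z, folded H_def[folded Z_def]]
  note [simp] = P[THEN carr(1)] \<Psi>[THEN carr(1)] W[THEN carr(2)] Z[THEN carr(1)] H(1)[THEN carr(1)]
  note [simp] = carr(3)
  have det': "even_det Z = even_det P"
    using det by (simp add: Z_def)
  have "Z * (\<Psi> * W) = (P * \<Psi>) * W - W * \<Psi> * W * \<Psi> * W"
    unfolding Z_def by (simp add: distribs assoc)
  also have "(P * \<Psi>) * W = W * (\<Psi> * P)"
    by (simp add: P\<Psi> \<Psi>P smult_one_mult mult_smult_one c)
  also have "W * (\<Psi> * P) - W * \<Psi> * W * \<Psi> * W = W * \<Psi> * Z"
    unfolding Z_def by (simp add: distribs assoc)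
  finally have Z\<Psi>W: "Z * (\<Psi> * W) = W * \<Psi> * Z" .
  have "even_det P \<cdot>\<^sub>m (\<Psi> * W * H) = (H * Z) * (\<Psi> * W) * H"
    by (simp add: H(3) det' smult_one_mult mult_even_smult(2)[of _ n] left_mult_one_mat[of _ n n])
  also have "\<dots> = H * (Z * (\<Psi> * W)) * H"
    by (simp add: assoc)
  also have "\<dots> = H * (W * \<Psi>) * (Z * H)"
    unfolding Z\<Psi>W by (simp add: assoc)
  also have "\<dots> = even_det P \<cdot>\<^sub>m (H * (W * \<Psi>))"
    by (simp add: H(2) det' mult_smult_one)
  finally have eq: "even_det P \<cdot>\<^sub>m (\<Psi> * W * H) = even_det P \<cdot>\<^sub>m (H * (W * \<Psi>))" .
  show ?thesis
  proof (rule eq_matI)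
    fix i j assume "i < dim_row (\<Psi> * W * H)" "j < dim_col (\<Psi> * W * H)"
    then have ij: "i < n" "j < n"
      using H(1) \<Psi> by (simp_all add: even_matsD)
    have [simp]: "dim_row (\<Psi> * W * H) = n" "dim_col (\<Psi> * W * H) = n"
      "dim_row (H * (W * \<Psi>)) = n" "dim_col (H * (W * \<Psi>)) = n"
      using H(1) \<Psi> by (simp_all add: even_matsD)
    have "even_det P * (\<Psi> * W * H) $$ (i, j) = even_det P * (H * (W * \<Psi>)) $$ (i, j)"
      using arg_cong[OF eq, of "\<lambda>M. M $$ (i, j)"] ij by (simp del: index_mult_mat)
    then have "even_det P * ((\<Psi> * W * H) $$ (i, j) - (H * (W * \<Psi>)) $$ (i, j)) = 0"
      by (simp add: right_diff_distrib del: index_mult_mat)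
    from cancel[OF this] have "(\<Psi> * W * H) $$ (i, j) - (H * (W * \<Psi>)) $$ (i, j) = 0" .
    then show "(H * (W * \<Psi>)) $$ (i, j) = (\<Psi> * W * H) $$ (i, j)"
      by simp
  qed (use H(1) \<Psi> in \<open>simp_all add: even_matsD\<close>)
qed

text \<open>The increment of the matrix is \<open>O' * D\<close>, and by the first order expansion
  the determinant changes by the trace of \<open>H * (O' * D)\<close>. The two terms of
  \<open>O'\<close> have equal traces after a cyclic shift and \<open>adj_commute\<close>; the sign
  between them comes from \<open>D\<close> anticommuting with the odd matrix
  \<open>\<Psi> * W\<close>.\<close>

lemma even_det_step:
  assumes W: "W \<in> odd_mats n" and N: "N \<in> even_mats n" and k: "k \<in> {1..LENGTH('m)}"
    and det: "even_det (P - W * \<Psi> * W) = even_det P"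
  defines "D \<equiv> gen_mat n k"
  shows "even_det (P - (W + N * D) * \<Psi> * (W + N * D)) = even_det P"
proof -
  define Z where "Z = P - W * \<Psi> * W"
  define H where "H = even_adj Z"
  \<comment> \<open>What multiplies \<open>D\<close> once the product is expanded: the term with two
    factors \<open>D\<close> dies because \<open>D * D = 0\<close>, and in
    \<open>N * D * \<Psi> * W\<close> moving \<open>D\<close> to the right end reverses the
    sign.\<close>
  define O' where "O' = N * \<Psi> * W - W * \<Psi> * N"
  have D: "D \<in> odd_mats n"
    unfolding D_def by (rule gen_mat_odd[OF k])
  have Z: "Z \<in> even_mats n"
    unfolding Z_def by (intro even_mats_diff P even_mats_mult_odd odd_mats_mult_left W \<Psi>)
  have O': "O' \<in> odd_mats n"
    unfolding O'_def by (intro odd_mats_diff odd_mats_mult_left odd_mats_mult_right even_mats_mult W N \<Psi>)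
  note H = even_adj[OF Z, folded H_def]
  note [simp] = P[THEN carr(1)] \<Psi>[THEN carr(1)] W[THEN carr(2)] Z[THEN carr(1)] H(1)[THEN carr(1)]
    N[THEN carr(1)] D[THEN carr(2)] O'[THEN carr(2)]
  note [simp] = carr(3)
  have rearrange: "A + - C + B = A + B - C" "E \<in> carrier_mat n n \<Longrightarrow> E - (A + B - C) = E - A + (C - B)"
    if "A \<in> carrier_mat n n" "B \<in> carrier_mat n n" "C \<in> carrier_mat n n"
    for A B C E :: "('m, 'r) grassmann mat"
    using that by (intro eq_matI; simp)+
  have mult_uminus: "A * - B = - (A * B)" if "A \<in> carrier_mat n n" "B \<in> carrier_mat n n"
    for A B :: "('m, 'r) grassmann mat"
    using that by simp
  have D\<Psi>W: "D * (\<Psi> * W) = - (\<Psi> * W * D)"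
    unfolding D_def by (rule gen_mat_commute_odd[OF k odd_mats_mult_right[OF \<Psi> W]])
  have D\<Psi>N: "D * (\<Psi> * N * D) = 0\<^sub>m n n"
  proof -
    have "D * (\<Psi> * N * D) = (D * (\<Psi> * N)) * D"
      by (simp add: assoc)
    also have "D * (\<Psi> * N) = \<Psi> * N * D"
      unfolding D_def by (rule gen_mat_commute_even[OF k even_mats_mult[OF \<Psi> N]])
    also have "\<Psi> * N * D * D = \<Psi> * N * (D * D)"
      by (simp add: assoc)
    also have "\<dots> = 0\<^sub>m n n"
      unfolding D_def gen_mat_square[OF k] by (rule right_mult_zero_mat[of _ n n]) simp
    finally show ?thesis .
  qed
  have "(W + N * D) * \<Psi> * (W + N * D) = (W + N * D) * (\<Psi> * W + \<Psi> * N * D)"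
    by (simp add: distribs assoc)
  also have "\<dots> = (W * \<Psi> * W + N * (D * (\<Psi> * W))) + (W * \<Psi> * N * D + N * (D * (\<Psi> * N * D)))"
    by (simp add: distribs assoc)
  also have "\<dots> = (W * \<Psi> * W + W * \<Psi> * N * D) - N * \<Psi> * W * D"
    unfolding D\<Psi>W D\<Psi>N
    by (simp add: assoc right_mult_zero_mat[of _ n n] mult_uminus rearrange)
  finally have "P - (W + N * D) * \<Psi> * (W + N * D) =
      P - ((W * \<Psi> * W + W * \<Psi> * N * D) - N * \<Psi> * W * D)"
    by simp
  also have "\<dots> = Z + (N * \<Psi> * W * D - W * \<Psi> * N * D)"
    unfolding Z_def by (rule rearrange) simp_all
  also have "N * \<Psi> * W * D - W * \<Psi> * N * D = O' * D"
    by (simp add: O'_def distribs)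
  finally have eq: "P - (W + N * D) * \<Psi> * (W + N * D) = Z + O' * D" .
  have "(O' * D) $$ (i, j) * (O' * D) $$ (i', j') = 0" if "i < n" "j < n" "i' < n" "j' < n" for i j i' j'
    using that unfolding D_def
    by (simp add: mult_gen_mat_index odd_mult_gen_product[OF k odd_matsD(3)[OF O']] del: index_mult_mat)
  then have "even_det (Z + O' * D) = even_det Z + mat_trace (H * (O' * D))"
    unfolding H_def by (rule even_det_add_square_zero[OF Z even_mats_mult_odd[OF O' D]])
  also have "mat_trace (H * (O' * D)) = 0"
  proof -
    \<comment> \<open>\<open>H * N\<close> is even, so it may be moved cyclically to the back of the
      trace and past \<open>D\<close>. Only then does \<open>H\<close> stand next to
      \<open>\<Psi> * W\<close>, where \<open>adj_commute\<close> applies.\<close>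
    have HN: "H * N \<in> even_mats n"
      by (intro even_mats_mult H N)
    have "mat_trace (H * (N * \<Psi> * W * D)) = mat_trace ((H * N) * (\<Psi> * W * D))"
      by (simp add: assoc)
    also have "\<dots> = mat_trace ((\<Psi> * W * D) * (H * N))"
      by (rule mat_trace_even_commute[OF HN]) simp
    also have "(\<Psi> * W * D) * (H * N) = \<Psi> * W * (D * (H * N))"
      by (simp add: assoc)
    also have "D * (H * N) = H * N * D"
      unfolding D_def by (rule gen_mat_commute_even[OF k HN])
    also have "\<Psi> * W * (H * N * D) = \<Psi> * W * H * (N * D)"
      by (simp add: assoc)
    also have "\<Psi> * W * H = H * (W * \<Psi>)"
      using adj_commute[OF W det] by (simp add: H_def Z_def)
    also have "H * (W * \<Psi>) * (N * D) = H * (W * \<Psi> * N * D)"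
      by (simp add: assoc)
    finally have tr: "mat_trace (H * (N * \<Psi> * W * D)) = mat_trace (H * (W * \<Psi> * N * D))" .
    have "H * (O' * D) = H * (N * \<Psi> * W * D) - H * (W * \<Psi> * N * D)"
      unfolding O'_def by (simp add: distribs)
    then show ?thesis
      by (simp add: mat_trace_diff[of _ n] tr)
  qed
  finally show ?thesis
    using det by (simp add: eq Z_def)
qed

theorem even_det_odd_perturbation:
  assumes V: "V \<in> odd_mats n"
  shows "even_det (P - V * \<Psi> * V) = even_det P"
proof -
  have "\<forall>p\<in>{..<n} \<times> {..<n}. \<exists>c. (\<forall>i. geven (c i)) \<and> V $$ p = (\<Sum>i\<in>{1..LENGTH('m)}. c i * gen i)"
  proof
    fix p assume "p \<in> {..<n} \<times> {..<n}"
    then have "godd (V $$ p)"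
      using odd_matsD(3)[OF V] by auto
    from godd_gens[OF this]
    show "\<exists>c. (\<forall>i. geven (c i)) \<and> V $$ p = (\<Sum>i\<in>{1..LENGTH('m)}. c i * gen i)"
      by metis
  qed
  \<comment> \<open>From here on \<open>c\<close> denotes the even coefficients of the generators in
    the entries of \<open>V\<close>, no longer the scalar fixed by the locale.\<close>
  then obtain c where c: "\<And>p i. p \<in> {..<n} \<times> {..<n} \<Longrightarrow> geven (c p i)"
    and V_eq: "\<And>p. p \<in> {..<n} \<times> {..<n} \<Longrightarrow> V $$ p = (\<Sum>i\<in>{1..LENGTH('m)}. c p i * gen i)"
    by metis
  define W where "W I = mat n n (\<lambda>p. \<Sum>i\<in>I. c p i * gen i)" for I
  have W: "W I \<in> odd_mats n" if "I \<subseteq> {1..LENGTH('m)}" for I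
  proof (rule odd_matsI)
    fix i j assume "i < n" "j < n"
    moreover have "godd (\<Sum>k\<in>I. c (i, j) k * gen k)"
      using \<open>i < n\<close> \<open>j < n\<close> that by (intro godd_sum godd_mult_right c godd_gen) auto
    ultimately show "godd (W I $$ (i, j))"
      by (simp add: W_def)
  qed (simp_all add: W_def)
  \<comment> \<open>\<open>W I\<close> keeps the part of the chosen expansion of \<open>V\<close>
    that involves the generators indexed by \<open>I\<close>; it runs from the zero matrix to
    \<open>V\<close>, and inserting \<open>k\<close> adds \<open>N * gen_mat n k\<close>.\<close>
  have "even_det (P - W I * \<Psi> * W I) = even_det P" if "finite I" "I \<subseteq> {1..LENGTH('m)}" for I
    using that
  proof (induction rule: finite_induct)
    case empty
    have "P - W {} * \<Psi> * W {} = P"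
      using even_matsD[OF P] even_matsD[OF \<Psi>]
      by (intro eq_matI) (auto simp: W_def scalar_prod_def)
    then show ?case by simp
  next
    case (insert k I)
    define N where "N = mat n n (\<lambda>p. c p k)"
    have N: "N \<in> even_mats n"
      by (auto simp: N_def intro!: even_matsI c)
    have "W (insert k I) = W I + N * gen_mat n k"
      using insert.hyps N[THEN even_mats_carrier]
      by (intro eq_matI) (simp_all add: W_def N_def mult_gen_mat_index add.commute del: index_mult_mat(1))
    then show ?case
      using even_det_step[OF W N] insert by simp
  qed
  from this[of "{1..LENGTH('m)}"] have "even_det (P - W {1..LENGTH('m)} * \<Psi> * W {1..LENGTH('m)}) = even_det P"
    by simp
  moreover have "W {1..LENGTH('m)} = V"
    using odd_matsD(1,2)[OF V] by (intro eq_matI) (auto simp: W_def V_eq)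
  ultimately show ?thesis
    by simp
qed

end

section \<open>Change of scalars and polynomial coefficients\<close>

definition map_grassmann :: "('r \<Rightarrow> 's) \<Rightarrow> ('m::len0, 'r::comm_ring_1) grassmann \<Rightarrow> ('m, 's::comm_ring_1) grassmann"
  where "map_grassmann \<phi> x = abs_grassmann (Poly_Mapping.map \<phi> (rep_grassmann x))"

text \<open>Only additivity is demanded because taking a coefficient of a polynomial is not
  multiplicative.\<close>

locale additive_map =
  fixes \<phi> :: "'r::comm_ring_1 \<Rightarrow> 's::comm_ring_1"
  assumes hom_add: "\<phi> (a + b) = \<phi> a + \<phi> b"
begin

lemma hom_zero: "\<phi> 0 = 0"
  using hom_add[of 0 0, symmetric] by simp

lemma hom_diff: "\<phi> (a - b) = \<phi> a - \<phi> b"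
  using hom_add[of "a - b" b] by simp

lemma lookup_map: "Poly_Mapping.lookup (Poly_Mapping.map \<phi> p) w = \<phi> (Poly_Mapping.lookup p w)"
  by (simp add: map.rep_eq when_def hom_zero)

lemma map_add: "Poly_Mapping.map \<phi> (p + q) = Poly_Mapping.map \<phi> p + Poly_Mapping.map \<phi> q"
  by (rule poly_mapping_eqI) (simp add: lookup_map lookup_add hom_add)

lemma map_diff: "Poly_Mapping.map \<phi> (p - q) = Poly_Mapping.map \<phi> p - Poly_Mapping.map \<phi> q"
  by (rule poly_mapping_eqI) (simp add: lookup_map lookup_minus hom_diff)

lemma map_single: "Poly_Mapping.map \<phi> (Poly_Mapping.single w a) = Poly_Mapping.single w (\<phi> a)"
  by (rule poly_mapping_eqI) (simp add: lookup_map lookup_single when_def hom_zero)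

text \<open>The relations have coefficients 0 and 1. In \<open>u * s * w\<close> with monomials
  \<open>u\<close> and \<open>w\<close> the two outer coefficients therefore merge into one product
  \<open>a * b\<close>, and an additive \<open>\<phi>\<close> only has to act on that.\<close>

lemma map_grassmann_ideal:
  fixes p :: "('m::len0, 'r) free_alg"
  assumes "p \<in> two_sided_ideal grassmann_relations"
  shows "Poly_Mapping.map \<phi> p \<in> two_sided_ideal grassmann_relations"
  using assms
proof (induction rule: two_sided_ideal_monomial_induct)
  case zero
  have "Poly_Mapping.map \<phi> (0 :: ('m, 'r) free_alg) = 0"
    by (rule poly_mapping_eqI) (simp add: lookup_map hom_zero)
  then show ?case
    by (simp add: two_sided_ideal.zero)
next
  case (mult s u a w b)
  have "\<exists>s' \<in> grassmann_relations. Poly_Mapping.map \<phi> (Poly_Mapping.single u a * s * Poly_Mapping.single w b) =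
    Poly_Mapping.single u (\<phi> (a * b)) * s' * Poly_Mapping.single w 1"
    using mult[unfolded grassmann_relations_def]
  proof
    assume "s \<in> {free_var k * free_var k |k. k \<in> {1..LENGTH('m)}}"
    then obtain k where k: "k \<in> {1..LENGTH('m)}" and s: "s = free_var k * free_var k"
      by blast
    show ?thesis
      by (rule bexI[of _ "free_var k * free_var k"])
         (use k in \<open>auto simp: s free_var_def mult_single map_single grassmann_relations_def\<close>)
  next
    assume "s \<in> {free_var i * free_var j + free_var j * free_var i |i j. 1 \<le> i \<and> i < j \<and> j \<le> LENGTH('m)}"
    then obtain i j where ij: "1 \<le> i \<and> i < j \<and> j \<le> LENGTH('m)"
      and s: "s = free_var i * free_var j + free_var j * free_var i"
      by blast
    show ?thesis
    proof (rule bexI[of _ "free_var i * free_var j + free_var j * free_var i"])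
      show "free_var i * free_var j + free_var j * free_var i \<in> (grassmann_relations :: ('m, 's) free_alg set)"
        using ij unfolding grassmann_relations_def by blast
    qed (simp add: s free_var_def mult_single map_single map_add distrib_left distrib_right)
  qed
  then show ?case
    by (auto intro: two_sided_ideal.mult)
qed (simp add: map_add two_sided_ideal.add)

lemma map_grassmann_abs: "map_grassmann \<phi> (abs_grassmann p) = abs_grassmann (Poly_Mapping.map \<phi> p)"
proof -
  have "abs_grassmann (rep_grassmann (abs_grassmann p)) = abs_grassmann p"
    by (rule Quotient3_abs_rep[OF Quotient3_grassmann])
  then have "rep_grassmann (abs_grassmann p) - p \<in> two_sided_ideal grassmann_relations"
    by (simp add: grassmann.abs_eq_iff)
  from map_grassmann_ideal[OF this] show ?thesis
    by (simp add: map_grassmann_def grassmann.abs_eq_iff map_diff)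
qed

lemma map_grassmann_monomial: "map_grassmann \<phi> (monomial w a) = monomial w (\<phi> a)"
  by (simp add: map_grassmann_abs map_single)

lemma map_grassmann_add: "map_grassmann \<phi> (x + y) = map_grassmann \<phi> x + map_grassmann \<phi> y"
proof -
  obtain p q where "x = abs_grassmann p" "y = abs_grassmann q"
    using abs_grassmann_surj by metis
  then show ?thesis
    by (simp add: map_grassmann_abs map_add plus_grassmann.abs_eq)
qed

lemma map_grassmann_0: "map_grassmann \<phi> 0 = 0"
  using map_grassmann_add[of 0 0, symmetric] by simp

lemma map_grassmann_diff: "map_grassmann \<phi> (x - y) = map_grassmann \<phi> x - map_grassmann \<phi> y"
  using map_grassmann_add[of "x - y" y] by simp

lemma map_grassmann_sum: "map_grassmann \<phi> (sum g T) = (\<Sum>t\<in>T. map_grassmann \<phi> (g t))"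
  by (induction T rule: infinite_finite_induct) (simp_all add: map_grassmann_0 map_grassmann_add)

lemma degree_part_map_grassmann: "degree_part i (map_grassmann \<phi> x) = map_grassmann \<phi> (degree_part i x)"
  by (induction x rule: grassmann_induct)
     (simp_all add: map_grassmann_monomial map_grassmann_add map_grassmann_0 degree_part_monomial degree_part_add)

end

text \<open>Reads the Grassmann algebra over \<open>R[x]\<close> as polynomials over the one over
  \<open>R\<close>: this is the coefficient of the \<open>j\<close>-th power of the variable, which
  is \<open>scalar [:0, 1:]\<close>.\<close>

definition gcoeff :: "nat \<Rightarrow> ('m::len0, 'r::comm_ring_1 poly) grassmann \<Rightarrow> ('m, 'r) grassmann" where
  "gcoeff j = map_grassmann (\<lambda>p. coeff p j)"

definition gconst :: "('m::len0, 'r::comm_ring_1) grassmann \<Rightarrow> ('m, 'r poly) grassmann" where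
  "gconst = map_grassmann (\<lambda>c. [:c:])"

interpretation gcoeff: additive_map "\<lambda>p. coeff p j"
  rewrites "map_grassmann (\<lambda>p. coeff p j) = gcoeff j"
  by unfold_locales (simp_all add: gcoeff_def)

interpretation gconst: additive_map "\<lambda>c. [:c:]"
  rewrites "map_grassmann (\<lambda>c. [:c:]) = gconst"
  by unfold_locales (simp_all add: gconst_def)

lemma gcoeff_gconst_mult: "gcoeff j (gconst x * y) = x * gcoeff j y"
proof (induction x rule: grassmann_induct)
  case (monomial u a)
  show ?case
    by (induction y rule: grassmann_induct)
       (simp_all add: gconst.map_grassmann_monomial gcoeff.map_grassmann_monomial monomial_mult
         gcoeff.map_grassmann_add distrib_left)
qed (simp add: gconst.map_grassmann_add gcoeff.map_grassmann_add distrib_right)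

lemma gcoeff_scalar_mult: "gcoeff j (scalar p * x) = (\<Sum>i\<le>j. scalar (coeff p i) * gcoeff (j - i) x)"
proof (induction x rule: grassmann_induct)
  case (monomial w a)
  have "monomial w (sum g T) = (\<Sum>t\<in>T. monomial w (g t))" for g :: "nat \<Rightarrow> 'b" and T
    by (induction T rule: infinite_finite_induct) (simp_all flip: monomial_add)
  then show ?case
    by (simp add: scalar_eq_monomial monomial_mult gcoeff.map_grassmann_monomial coeff_mult)
qed (simp add: gcoeff.map_grassmann_add distrib_left sum.distrib)

lemma gcoeff_scalar: "gcoeff j (scalar p) = scalar (coeff p j)"
  by (simp add: scalar_eq_monomial gcoeff.map_grassmann_monomial)

lemma gcoeff_X_mult:
  "gcoeff 0 (scalar [:0, 1:] * x) = 0" "gcoeff (Suc j) (scalar [:0, 1:] * x) = gcoeff j x"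
proof -
  show "gcoeff 0 (scalar [:0, 1:] * x) = 0"
    by (simp add: gcoeff_scalar_mult)
  have "(\<Sum>i\<le>Suc j. scalar (coeff [:0, 1:] i) * gcoeff (Suc j - i) x) =
      (\<Sum>i\<in>{1}. scalar (coeff [:0, 1:] i) * gcoeff (Suc j - i) x)"
    by (rule sum.mono_neutral_right) (auto simp: coeff_pCons split: nat.splits)
  then show "gcoeff (Suc j) (scalar [:0, 1:] * x) = gcoeff j x"
    by (simp add: gcoeff_scalar_mult)
qed

text \<open>The claim for all large \<open>n\<close>, rather than for one bound, lets the bounds of
  two summands be merged by their maximum.\<close>

lemma gcoeff_expansion:
  "\<exists>N. \<forall>n\<ge>N. x = (\<Sum>j\<le>n. scalar (monom 1 j) * gconst (gcoeff j x)) \<and> gcoeff n x = 0"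
proof (induction x rule: grassmann_induct)
  case (monomial w a)
  have sum: "monomial w (sum g T) = (\<Sum>t\<in>T. monomial w (g t))" for g :: "nat \<Rightarrow> 'b poly" and T
    by (induction T rule: infinite_finite_induct) (simp_all flip: monomial_add)
  have "monomial w a = (\<Sum>j\<le>n. scalar (monom 1 j) * gconst (gcoeff j (monomial w a))) \<and>
      gcoeff n (monomial w a) = 0" if "n \<ge> Suc (degree a)" for n
  proof -
    have "a = (\<Sum>j\<le>n. monom 1 j * [:coeff a j:])"
      using that poly_as_sum_of_monoms'[of a n] by (simp add: smult_monom mult.commute[of "monom 1 _"])
    then have "monomial w a = (\<Sum>j\<le>n. monomial w (monom 1 j * [:coeff a j:]))"
      by (metis sum)
    also have "\<dots> = (\<Sum>j\<le>n. scalar (monom 1 j) * gconst (gcoeff j (monomial w a)))"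
      by (simp only: gcoeff.map_grassmann_monomial gconst.map_grassmann_monomial scalar_eq_monomial
          monomial_mult add_0)
    finally have "monomial w a = (\<Sum>j\<le>n. scalar (monom 1 j) * gconst (gcoeff j (monomial w a)))" .
    moreover have "gcoeff n (monomial w a) = 0"
      using that by (simp add: gcoeff.map_grassmann_monomial coeff_eq_0)
    ultimately show ?thesis ..
  qed
  then show ?case by blast
next
  case (add x y)
  then obtain M N where
    "\<forall>n\<ge>M. x = (\<Sum>j\<le>n. scalar (monom 1 j) * gconst (gcoeff j x)) \<and> gcoeff n x = 0"
    "\<forall>n\<ge>N. y = (\<Sum>j\<le>n. scalar (monom 1 j) * gconst (gcoeff j y)) \<and> gcoeff n y = 0"
    by blast
  then have "x + y = (\<Sum>j\<le>n. scalar (monom 1 j) * gconst (gcoeff j (x + y))) \<and> gcoeff n (x + y) = 0"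
    if "n \<ge> max M N" for n
    using that by (simp add: gcoeff.map_grassmann_add gconst.map_grassmann_add distrib_left sum.distrib)
  then show ?case by blast
qed

lemma gcoeff_eventually_0: "\<exists>N. \<forall>n\<ge>N. gcoeff n x = 0"
  using gcoeff_expansion by blast

lemma gcoeff_eq_0_imp_0:
  assumes "\<And>j. gcoeff j x = 0"
  shows "x = 0"
proof -
  obtain N where "x = (\<Sum>j\<le>N. scalar (monom 1 j) * gconst (gcoeff j x))"
    using gcoeff_expansion[of x] by blast
  also have "\<dots> = 0"
    by (simp add: assms gconst.map_grassmann_0)
  finally show ?thesis .
qed

text \<open>The leading coefficient argument, valid over any commutative \<open>R\<close>. It is the
  substitute for dividing by \<open>f\<close>.\<close>

lemma monic_scalar_cancel:
  assumes monic: "lead_coeff p = 1" and eq: "scalar p * x = 0"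
  shows "x = (0 :: ('m::len0, 'r::comm_ring_1 poly) grassmann)"
proof (rule gcoeff_eq_0_imp_0)
  obtain N where N: "\<And>n. n \<ge> N \<Longrightarrow> gcoeff n x = 0"
    using gcoeff_eventually_0 by blast
  \<comment> \<open>Descending induction on \<open>n\<close>. In the coefficient of index
    \<open>n + degree p\<close> of the product, indices below \<open>degree p\<close> meet
    coefficients of \<open>x\<close> already known to vanish, and indices above it meet zero
    coefficients of \<open>p\<close>; \<open>gcoeff n x\<close> is left.\<close>
  have "gcoeff n x = 0" if "n + k = N" for k n
    using that
  proof (induction k arbitrary: n rule: less_induct)
    case (less k)
    have higher: "gcoeff n' x = 0" if "n' > n" for n'
      using less.IH[of "N - n'" n'] less.prems that N[of n'] by (cases "n' < N") auto
    have "0 = (\<Sum>i\<le>n + degree p. scalar (coeff p i) * gcoeff (n + degree p - i) x)"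
      using eq by (simp flip: gcoeff_scalar_mult add: gcoeff.map_grassmann_0)
    also have "\<dots> = (\<Sum>i\<in>{degree p}. scalar (coeff p i) * gcoeff (n + degree p - i) x)"
    proof (rule sum.mono_neutral_right)
      show "\<forall>i\<in>{..n + degree p} - {degree p}. scalar (coeff p i) * gcoeff (n + degree p - i) x = 0"
      proof
        fix i assume "i \<in> {..n + degree p} - {degree p}"
        then consider "i < degree p" | "i > degree p" by force
        then show "scalar (coeff p i) * gcoeff (n + degree p - i) x = 0"
          by cases (simp_all add: higher coeff_eq_0)
      qed
    qed auto
    also have "\<dots> = gcoeff n x"
      using monic by simp
    finally show ?case by simp
  qed
  from this[of n "N - n" for n] show "gcoeff n x = 0" for n
    using N[of n] by (cases "n \<le> N") simp_all
qed

section \<open>Weighted degree components\<close>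

definition weight :: "(nat \<Rightarrow> 'r) \<Rightarrow> ('m::len0, 'r::comm_ring_1) grassmann \<Rightarrow> ('m, 'r) grassmann" where
  "weight g x = (\<Sum>d\<le>LENGTH('m). scalar (g d) * degree_part d x)"

lemma degree_part_weight: "degree_part i (weight g x) = scalar (g i) * degree_part i x"
proof (cases "i \<le> LENGTH('a)")
  case True
  have "degree_part i (weight g x) = (\<Sum>d\<le>LENGTH('a). if d = i then scalar (g i) * degree_part i x else 0)"
    unfolding weight_def degree_part_sum degree_part_scalar_mult
    by (rule sum.cong) (auto simp: degree_part_degree_part)
  then show ?thesis
    using True by simp
qed (simp add: degree_part_eq_0)

text \<open>The condition on the weights is asked only where a product of components can be nonzero.
  The bound on \<open>a + b\<close> keeps later exponents clear of truncated subtraction, and the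
  condition on \<open>degree_part b y\<close> lets the parity of \<open>y\<close> enter.\<close>

lemma weight_mult:
  fixes x y :: "('m::len0, 'r::comm_ring_1) grassmann"
  assumes "\<And>a b. a + b \<le> LENGTH('m) \<Longrightarrow> degree_part b y \<noteq> 0 \<Longrightarrow> h (a + b) * g a = g' a * h' b"
  shows "weight h (weight g x * y) = weight g' x * weight h' y"
proof (rule grassmann_eqI)
  fix i assume i: "i \<le> LENGTH('m)"
  have "scalar (h i) * (scalar (g a) * degree_part a x * degree_part (i - a) y) =
      scalar (g' a) * degree_part a x * (scalar (h' (i - a)) * degree_part (i - a) y)" if "a \<le> i" for a
  proof (cases "degree_part (i - a) y = 0")
    case False
    then have "h i * g a = g' a * h' (i - a)"
      using assms[of a "i - a"] that i by simp
    then have "scalar (h i) * scalar (g a) = scalar (g' a) * (scalar (h' (i - a)) :: ('m, 'r) grassmann)"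
      by (metis scalar_mult)
    then have "scalar (h i) * (scalar (g a) * degree_part a x * degree_part (i - a) y) =
        scalar (g' a) * (scalar (h' (i - a)) * degree_part a x) * degree_part (i - a) y"
      by (simp flip: mult.assoc)
    also have "scalar (h' (i - a)) * degree_part a x = degree_part a x * scalar (h' (i - a))"
      by (rule scalar_commute)
    finally show ?thesis
      by (simp add: mult.assoc)
  qed simp
  then show "degree_part i (weight h (weight g x * y)) = degree_part i (weight g' x * weight h' y)"
    by (simp add: degree_part_weight degree_part_mult sum_distrib_left)
qed

lemma weight_add: "weight g (x + y) = weight g x + weight g y"
  by (simp add: weight_def degree_part_add distrib_left sum.distrib)

lemma weight_0 [simp]: "weight g 0 = 0"
  by (simp add: weight_def)

lemma weight_diff: "weight g (x - y) = weight g x - weight g y"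
  by (simp add: weight_def degree_part_diff right_diff_distrib sum_subtractf)

lemma weight_sum: "weight g (sum f T) = (\<Sum>t\<in>T. weight g (f t))"
  by (induction T rule: infinite_finite_induct) (simp_all add: weight_add)

lemma weight_scalar_mult: "weight g (scalar c * x) = scalar c * weight g x"
  by (rule grassmann_eqI)
     (simp add: degree_part_weight degree_part_scalar_mult flip: scalar_mult mult.assoc, simp add: mult.commute)

lemma weight_scalar: "weight g (scalar c) = scalar (g 0 * c)"
  by (rule grassmann_eqI) (simp add: degree_part_weight degree_part_scalar flip: scalar_mult)

lemma geven_weight: "(\<And>d. odd d \<Longrightarrow> g d = 0) \<Longrightarrow> geven (weight g x)"
  by (simp add: geven_def degree_part_weight)

lemma godd_weight: "(\<And>d. even d \<Longrightarrow> g d = 0) \<Longrightarrow> godd (weight g x)"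
  by (simp add: godd_def degree_part_weight)

text \<open>The geometric series in \<open>- y\<close> terminates: without a degree zero part, the
  \<open>k\<close>-th power of \<open>y\<close> starts in degree \<open>k\<close>, beyond the rank
  for large \<open>k\<close>.\<close>

lemma even_one_plus_unit:
  fixes y :: "('m::len0, 'r::comm_ring_1) grassmann"
  assumes "geven y" "degree_part 0 y = 0"
  obtains u where "geven u" "(1 + y) * u = 1"
proof
  let ?u = "\<Sum>k\<le>LENGTH('m). (- y) ^ k"
  have ev: "geven ((- y) ^ k)" for k
    by (induction k) (simp_all add: geven_mult geven_uminus assms)
  then show "geven ?u"
    by (intro geven_sum)
  have low: "degree_part i ((- y) ^ k) = 0" if "i < k" for i k
    using that
  proof (induction k arbitrary: i)
    case (Suc k)
    have "degree_part a (- y) * degree_part (i - a) ((- y) ^ k) = 0" if "a \<le> i" for a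
      using Suc that assms(2) by (cases a) (simp_all add: degree_part_uminus)
    then show ?case
      unfolding power_Suc degree_part_mult by (intro sum.neutral) simp
  qed simp
  have "(1 + y) * (\<Sum>k\<le>N. (- y) ^ k) = 1 - (- y) ^ Suc N" for N
  proof (induction N)
    case (Suc N)
    have "(1 + y) * (\<Sum>k\<le>Suc N. (- y) ^ k) = (1 + y) * (\<Sum>k\<le>N. (- y) ^ k) + (1 + y) * (- y) ^ Suc N"
      by (simp only: sum.atMost_Suc distrib_left)
    also have "\<dots> = 1 - (- y) * (- y) ^ Suc N"
      unfolding Suc.IH by (simp add: distrib_right)
    finally show ?case
      by (simp only: power_Suc)
  qed (simp add: distrib_right)
  also have "(- y) ^ Suc (LENGTH('m)) = 0"
    by (rule grassmann_eqI) (simp add: low del: power_Suc)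
  finally show "(1 + y) * ?u = 1"
    by simp
qed

section \<open>Evaluating polynomials at matrices\<close>

lemma pow_mat_Suc_left: "A \<in> carrier_mat n n \<Longrightarrow> A ^\<^sub>m Suc k = A * (A ^\<^sub>m k :: 'a::semiring_1 mat)"
proof (induction k)
  case (Suc k)
  then have "A ^\<^sub>m Suc (Suc k) = A * A ^\<^sub>m k * A"
    by simp
  also have "\<dots> = A * A ^\<^sub>m Suc k"
    using Suc.prems by (simp add: assoc_mult_mat[of _ n n _ n _ n])
  finally show ?case .
qed simp

lemma eval_mat_poly_index:
  assumes "A \<in> carrier_mat n n" "degree p \<le> N" "i < n" "j < n"
  shows "eval_mat_poly p A $$ (i, j) = (\<Sum>k\<le>N. scalar (coeff p k) * (A ^\<^sub>m k) $$ (i, j))"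
proof -
  have "eval_mat_poly p A $$ (i, j) = (\<Sum>k\<le>degree p. scalar (coeff p k) * (A ^\<^sub>m k) $$ (i, j))"
    using assms by (simp add: eval_mat_poly_def)
  also have "\<dots> = (\<Sum>k\<le>N. scalar (coeff p k) * (A ^\<^sub>m k) $$ (i, j))"
    using assms(2) by (intro sum.mono_neutral_left) (auto simp: coeff_eq_0)
  finally show ?thesis .
qed

lemma eval_mat_poly_carrier [simp]: "A \<in> carrier_mat n n \<Longrightarrow> eval_mat_poly p A \<in> carrier_mat n n"
  by (simp add: eval_mat_poly_def)

lemma eval_mat_poly_dim:
  "A \<in> carrier_mat n n \<Longrightarrow> dim_row (eval_mat_poly p A) = n"
  "A \<in> carrier_mat n n \<Longrightarrow> dim_col (eval_mat_poly p A) = n"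
  by (simp_all add: eval_mat_poly_def)

lemma eval_mat_poly_0: "A \<in> carrier_mat n n \<Longrightarrow> eval_mat_poly 0 A = 0\<^sub>m n n"
  by (intro eq_matI) (simp_all add: eval_mat_poly_def)

lemma eval_mat_poly_1: "A \<in> carrier_mat n n \<Longrightarrow> eval_mat_poly 1 A = 1\<^sub>m n"
  by (intro eq_matI) (simp_all add: eval_mat_poly_def)

lemma eval_mat_poly_add:
  assumes A: "A \<in> carrier_mat n n"
  shows "eval_mat_poly (p + q) A = eval_mat_poly p A + eval_mat_poly q A"
proof (rule eq_matI)
  fix i j assume "i < dim_row (eval_mat_poly p A + eval_mat_poly q A)"
    "j < dim_col (eval_mat_poly p A + eval_mat_poly q A)"
  then have ij: "i < n" "j < n"
    using A by (simp_all add: eval_mat_poly_dim)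
  let ?N = "max (degree p) (degree q)"
  have "degree p \<le> ?N" "degree q \<le> ?N" "degree (p + q) \<le> ?N"
    by (simp_all add: degree_add_le)
  note eqs = this[THEN eval_mat_poly_index[OF A _ ij]]
  show "eval_mat_poly (p + q) A $$ (i, j) = (eval_mat_poly p A + eval_mat_poly q A) $$ (i, j)"
    using ij A by (simp add: eqs eval_mat_poly_dim scalar_add distrib_right sum.distrib)
qed (use A in \<open>simp_all add: eval_mat_poly_dim\<close>)

lemma eval_mat_poly_smult:
  assumes A: "A \<in> carrier_mat n n"
  shows "eval_mat_poly (Polynomial.smult c p) A = scalar c \<cdot>\<^sub>m eval_mat_poly p A"
proof (rule eq_matI)
  fix i j assume "i < dim_row (scalar c \<cdot>\<^sub>m eval_mat_poly p A)"
    "j < dim_col (scalar c \<cdot>\<^sub>m eval_mat_poly p A)"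
  then have ij: "i < n" "j < n"
    using A by (simp_all add: eval_mat_poly_dim)
  note eqs = order_refl[of "degree p", THEN eval_mat_poly_index[OF A _ ij]]
    degree_smult_le[of c p, THEN eval_mat_poly_index[OF A _ ij]]
  show "eval_mat_poly (Polynomial.smult c p) A $$ (i, j) = (scalar c \<cdot>\<^sub>m eval_mat_poly p A) $$ (i, j)"
    using ij A by (simp add: eqs eval_mat_poly_dim scalar_mult sum_distrib_left mult.assoc)
qed (use A in \<open>simp_all add: eval_mat_poly_dim\<close>)

lemma eval_mat_poly_pCons_0:
  assumes A: "A \<in> carrier_mat n n"
  shows "eval_mat_poly (pCons 0 p) A = A * eval_mat_poly p A"
proof (rule eq_matI)
  fix i j assume "i < dim_row (A * eval_mat_poly p A)" "j < dim_col (A * eval_mat_poly p A)"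
  then have ij: "i < n" "j < n"
    using A by (simp_all add: eval_mat_poly_dim)
  have "degree (pCons 0 p) \<le> Suc (degree p)"
    by (rule degree_pCons_le)
  note eq = this[THEN eval_mat_poly_index[OF A _ ij]]
  have "(A * eval_mat_poly p A) $$ (i, j) = (\<Sum>l<n. A $$ (i, l) * eval_mat_poly p A $$ (l, j))"
    using ij A by (simp add: eval_mat_poly_dim scalar_prod_def atLeast0LessThan)
  also have "\<dots> = (\<Sum>l<n. \<Sum>k\<le>degree p. scalar (coeff p k) * (A $$ (i, l) * (A ^\<^sub>m k) $$ (l, j)))"
  proof (rule sum.cong)
    fix l assume "l \<in> {..<n}"
    then have l: "l < n" by simp
    have "A $$ (i, l) * (scalar (coeff p k) * (A ^\<^sub>m k) $$ (l, j)) =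
        scalar (coeff p k) * (A $$ (i, l) * (A ^\<^sub>m k) $$ (l, j))" for k
      using scalar_commute[of "coeff p k" "A $$ (i, l)"] by (simp flip: mult.assoc)
    then show "A $$ (i, l) * eval_mat_poly p A $$ (l, j) =
        (\<Sum>k\<le>degree p. scalar (coeff p k) * (A $$ (i, l) * (A ^\<^sub>m k) $$ (l, j)))"
      by (simp add: eval_mat_poly_index[OF A order_refl l ij(2)] sum_distrib_left)
  qed simp
  also have "\<dots> = (\<Sum>k\<le>degree p. scalar (coeff p k) * (\<Sum>l<n. A $$ (i, l) * (A ^\<^sub>m k) $$ (l, j)))"
    by (subst sum.swap) (simp add: sum_distrib_left)
  also have "\<dots> = (\<Sum>k\<le>degree p. scalar (coeff p k) * (A ^\<^sub>m Suc k) $$ (i, j))"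
  proof (intro sum.cong refl)
    fix k
    have "(\<Sum>l<n. A $$ (i, l) * (A ^\<^sub>m k) $$ (l, j)) = (A * A ^\<^sub>m k) $$ (i, j)"
      using ij A by (simp add: scalar_prod_def atLeast0LessThan)
    then show "scalar (coeff p k) * (\<Sum>l<n. A $$ (i, l) * (A ^\<^sub>m k) $$ (l, j)) =
        scalar (coeff p k) * (A ^\<^sub>m Suc k) $$ (i, j)"
      by (simp only: pow_mat_Suc_left[OF A])
  qed
  also have "\<dots> = eval_mat_poly (pCons 0 p) A $$ (i, j)"
    unfolding eq sum.atMost_Suc_shift by (simp del: pow_mat.simps(2))
  finally show "eval_mat_poly (pCons 0 p) A $$ (i, j) = (A * eval_mat_poly p A) $$ (i, j)"
    by simp
qed (use A in \<open>simp_all add: eval_mat_poly_dim\<close>)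

text \<open>Evaluation is multiplicative despite the noncommuting entries, because the coefficients
  are central and all powers are of one matrix.\<close>

lemma eval_mat_poly_mult:
  fixes A :: "('m::len0, 'r::comm_ring_1) grassmann mat"
  assumes A: "A \<in> carrier_mat n n"
  shows "eval_mat_poly (p * q) A = eval_mat_poly p A * eval_mat_poly q A"
proof (induction p)
  case 0
  show ?case
    using A by (simp add: eval_mat_poly_0[OF A] left_mult_zero_mat[of _ n n])
next
  case (pCons a p)
  have "eval_mat_poly (pCons a p * q) A =
      scalar a \<cdot>\<^sub>m eval_mat_poly q A + A * (eval_mat_poly p A * eval_mat_poly q A)"
    by (simp add: eval_mat_poly_add[OF A] eval_mat_poly_smult[OF A] eval_mat_poly_pCons_0[OF A] pCons.IH)
  also have "\<dots> = (scalar a \<cdot>\<^sub>m 1\<^sub>m n) * eval_mat_poly q A + (A * eval_mat_poly p A) * eval_mat_poly q A"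
    using A by (simp add: smult_one_mult[of _ n] assoc_mult_mat[of _ n n _ n _ n])
  also have "\<dots> = (scalar a \<cdot>\<^sub>m 1\<^sub>m n + A * eval_mat_poly p A) * eval_mat_poly q A"
    using A by (intro add_mult_distrib_mat[symmetric, of _ n n _ _ n]) auto
  also have "scalar a \<cdot>\<^sub>m 1\<^sub>m n + A * eval_mat_poly p A = eval_mat_poly (Polynomial.smult a 1 + pCons 0 p) A"
    by (simp only: eval_mat_poly_add[OF A] eval_mat_poly_smult[OF A] eval_mat_poly_pCons_0[OF A] eval_mat_poly_1[OF A])
  also have "Polynomial.smult a 1 + pCons 0 p = pCons a p"
    by (simp add: one_pCons)
  finally show ?case .
qed

lemma eval_mat_poly_power:
  assumes A: "A \<in> carrier_mat n n"
  shows "eval_mat_poly (p ^ k) A = eval_mat_poly p A ^\<^sub>m k"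
  by (induction k)
     (use A in \<open>simp_all add: eval_mat_poly_1[OF A] eval_mat_poly_dim eval_mat_poly_mult[OF A]
        power_Suc2 del: power_Suc\<close>)

text \<open>
  The remainder theorem: dividing \<open>p\<close> by \<open>x - A\<close> on the left leaves the remainder \<open>p(A)\<close>.
\<close>

lemma eval_mat_poly_eq_0_if_divides:
  fixes A :: "('m::len0, 'r::comm_ring_1) grassmann mat"
  assumes A: "A \<in> carrier_mat n n" and Q: "Q \<in> carrier_mat n n"
    and eq: "(scalar [:0, 1:] \<cdot>\<^sub>m 1\<^sub>m n - map_mat gconst A) * Q = scalar p \<cdot>\<^sub>m 1\<^sub>m n"
  shows "eval_mat_poly p A = 0\<^sub>m n n"
proof -
  define q where "q j = map_mat (gcoeff j) Q" for j
  define c where "c j = scalar (coeff p j) \<cdot>\<^sub>m (1\<^sub>m n :: ('m, 'r) grassmann mat)" for j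
  have q [simp]: "q j \<in> carrier_mat n n" for j
    using Q by (simp add: q_def)
  have [simp]: "dim_row (q j) = n" "dim_col (q j) = n" for j
    using carrier_matD[OF q] by simp_all
  have dims [simp]: "dim_row A = n" "dim_col A = n" "dim_row Q = n" "dim_col Q = n"
    using A Q by auto
  have entry: "scalar [:0, 1:] * Q $$ (i, l) - (\<Sum>t<n. gconst (A $$ (i, t)) * Q $$ (t, l)) =
      scalar p * (1\<^sub>m n) $$ (i, l)" if "i < n" "l < n" for i l
  proof -
    have "(scalar [:0, 1:] \<cdot>\<^sub>m 1\<^sub>m n - map_mat gconst A) * Q = scalar [:0, 1:] \<cdot>\<^sub>m Q - map_mat gconst A * Q"
      using A Q by (simp add: minus_mult_distrib_mat[of _ n n _ _ n] smult_one_mult)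
    then have "(scalar [:0, 1:] \<cdot>\<^sub>m Q - map_mat gconst A * Q) $$ (i, l) = (scalar p \<cdot>\<^sub>m 1\<^sub>m n) $$ (i, l)"
      using eq by simp
    then show ?thesis
      using that by (simp add: scalar_prod_def atLeast0LessThan)
  qed
  have entry_coeff: "gcoeff j (scalar [:0, 1:] * Q $$ (i, l)) - (A * q j) $$ (i, l) = c j $$ (i, l)"
    if "i < n" "l < n" for i l j
  proof -
    have "gcoeff j (scalar [:0, 1:] * Q $$ (i, l)) - (A * q j) $$ (i, l) =
        gcoeff j (scalar [:0, 1:] * Q $$ (i, l) - (\<Sum>t<n. gconst (A $$ (i, t)) * Q $$ (t, l)))"
      using that by (simp add: q_def gcoeff.map_grassmann_diff gcoeff.map_grassmann_sum
          gcoeff_gconst_mult scalar_prod_def atLeast0LessThan)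
    also have "\<dots> = c j $$ (i, l)"
      unfolding entry[OF that] using that by (simp add: c_def gcoeff_scalar gcoeff.map_grassmann_0)
    finally show ?thesis .
  qed
  \<comment> \<open>Comparing coefficients of the variable in \<open>eq\<close>. Index 0 is special
    since the shift by the variable contributes nothing there.\<close>
  have c_0: "c 0 = - (A * q 0)"
    using entry_coeff[of _ _ 0] by (intro eq_matI) (simp_all add: gcoeff_X_mult c_def del: index_mult_mat(1))
  have c_Suc: "c (Suc j) = q j - A * q (Suc j)" for j
  proof (rule eq_matI)
    fix i l assume "i < dim_row (q j - A * q (Suc j))" "l < dim_col (q j - A * q (Suc j))"
    then have il: "i < n" "l < n"
      by simp_all
    then have "q j $$ (i, l) - (A * q (Suc j)) $$ (i, l) = c (Suc j) $$ (i, l)"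
      using entry_coeff[OF il, of "Suc j"] by (simp add: gcoeff_X_mult q_def del: index_mult_mat(1))
    then show "c (Suc j) $$ (i, l) = (q j - A * q (Suc j)) $$ (i, l)"
      using il by simp
  qed (simp_all add: c_def)
  define T where "T N = mat n n (\<lambda>(i, l). \<Sum>k\<le>N. scalar (coeff p k) * (A ^\<^sub>m k) $$ (i, l))" for N
  have T_Suc: "T (Suc N) = T N + A ^\<^sub>m Suc N * c (Suc N)" for N
  proof -
    have "A ^\<^sub>m Suc N * c (Suc N) = scalar (coeff p (Suc N)) \<cdot>\<^sub>m A ^\<^sub>m Suc N"
      unfolding c_def by (rule mult_smult_one) (use A in \<open>auto simp del: pow_mat.simps(2)\<close>)
    then show ?thesis
      using A by (intro eq_matI) (simp_all add: T_def del: pow_mat.simps(2))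
  qed
  \<comment> \<open>Multiplying the \<open>j\<close>-th coefficient identity by the
    \<open>j\<close>-th power of \<open>A\<close> from the left and adding up telescopes, so only
    the term with \<open>q N\<close> survives.\<close>
  have T: "T N = - (A ^\<^sub>m Suc N * q N)" for N
  proof (induction N)
    case 0
    have "T 0 = c 0"
      by (intro eq_matI) (simp_all add: T_def c_def)
    then show ?case
      using A by (simp add: c_0 left_mult_one_mat[of _ n n])
  next
    case (Suc N)
    have pow: "A ^\<^sub>m k \<in> carrier_mat n n" for k
      using A by simp
    have "A ^\<^sub>m Suc N * c (Suc N) = A ^\<^sub>m Suc N * q N - A ^\<^sub>m Suc N * (A * q (Suc N))"
      unfolding c_Suc using A pow[of "Suc N"]
      by (intro mult_minus_distrib_mat[of _ n n _ n]) auto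
    also have "A ^\<^sub>m Suc N * (A * q (Suc N)) = A ^\<^sub>m Suc (Suc N) * q (Suc N)"
      unfolding pow_mat.simps(2)[of A "Suc N"] using pow[of "Suc N"] A
      by (intro assoc_mult_mat[symmetric, of _ n n _ n _ n]) auto
    finally have "T (Suc N) = - (A ^\<^sub>m Suc N * q N) + (A ^\<^sub>m Suc N * q N - A ^\<^sub>m Suc (Suc N) * q (Suc N))"
      by (simp only: T_Suc Suc.IH)
    then show ?case
      by (simp only:) (intro eq_matI; simp del: index_mult_mat(1) pow_mat.simps(2))
  qed
  have "\<exists>N0. \<forall>s. \<forall>j\<ge>N0 s. gcoeff j (Q $$ s) = 0"
    using gcoeff_eventually_0 by (intro choice) blast
  then obtain N0 where N0: "\<And>i l j. j \<ge> N0 (i, l) \<Longrightarrow> gcoeff j (Q $$ (i, l)) = 0"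
    by blast
  \<comment> \<open>Large enough for \<open>T N\<close> to contain all of \<open>p\<close> and for
    the coefficient matrix \<open>q N\<close> to vanish.\<close>
  define N where "N = max (degree p) (Max (insert 0 (N0 ` ({..<n} \<times> {..<n}))))"
  have "N0 (i, l) \<le> N" if "i < n" "l < n" for i l
    using that unfolding N_def by (intro max.coboundedI2 Max_ge) auto
  then have "q N = 0\<^sub>m n n"
    by (intro eq_matI) (simp_all add: q_def N0)
  then have "T N = 0\<^sub>m n n"
    unfolding T using A by (intro eq_matI) (simp_all add: right_mult_zero_mat[of _ n n] del: pow_mat.simps(2))
  moreover have "degree p \<le> N"
    by (simp add: N_def)
  then have "T N = eval_mat_poly p A"
    using eval_mat_poly_index[OF A, of p N] by (intro eq_matI) (simp_all add: T_def eval_mat_poly_dim[OF A])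
  ultimately show ?thesis
    by simp
qed

section \<open>The annihilating polynomial\<close>

lemma even_det_scalar:
  fixes M :: "'r::comm_ring_1 mat"
  shows "even_det (map_mat scalar M :: ('m::len0, 'r) grassmann mat) = scalar (det M)"
proof -
  interpret comm_ring_hom "\<lambda>a. to_even (scalar a) :: ('m, 'r) even_grassmann"
    by unfold_locales
       (simp_all add: scalar_add scalar_mult of_even_to_even geven_add geven_mult
         of_even.hom_add of_even.hom_mult flip: of_even_inject)
  have "map_mat to_even (map_mat scalar M) = map_mat (\<lambda>a. to_even (scalar a) :: ('m, 'r) even_grassmann) M"
    by (intro eq_matI) simp_all
  then show ?thesis
    by (simp add: even_det_def hom_det of_even_to_even)
qed

lemma map_weight_mult:
  fixes M N :: "('m::len0, 'r::comm_ring_1) grassmann mat"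
  assumes M: "M \<in> carrier_mat n n" and N: "N \<in> carrier_mat n n"
    and "\<And>a b i j. a + b \<le> LENGTH('m) \<Longrightarrow> i < n \<Longrightarrow> j < n \<Longrightarrow> degree_part b (N $$ (i, j)) \<noteq> 0 \<Longrightarrow>
      h (a + b) * g a = g' a * h' b"
  shows "map_mat (weight h) (map_mat (weight g) M * N) = map_mat (weight g') M * map_mat (weight h') N"
  using assms
  by (intro eq_matI) (auto simp: scalar_prod_def weight_sum intro!: sum.cong weight_mult)

lemma map_weight_diff:
  "M \<in> carrier_mat n n \<Longrightarrow> N \<in> carrier_mat n n \<Longrightarrow>
    map_mat (weight h) (M - N) = map_mat (weight h) M - map_mat (weight h) N"
  by (intro eq_matI) (auto simp: weight_diff)

lemma map_weight_smult:
  "map_mat (weight h) (scalar c \<cdot>\<^sub>m M) = scalar c \<cdot>\<^sub>m map_mat (weight h) M"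
  by (intro eq_matI) (simp_all add: weight_scalar_mult)

lemma weight_mult_left: "weight (\<lambda>d. c * h d) x = scalar c * weight h x"
  by (simp add: weight_def scalar_mult sum_distrib_left mult.assoc)

lemma even_odd_decomposition:
  "x = weight (\<lambda>d. of_bool (even d)) x + weight (\<lambda>d. of_bool (odd d)) x"
  by (rule grassmann_eqI) (simp add: degree_part_add degree_part_weight)

text \<open>
  The resolvent of \<open>A\<close> has the denominator \<open>f ^ Suc k\<close> only. In place of dividing by \<open>f\<close>, the
  component of degree \<open>d\<close> of \<open>A\<close> is multiplied by \<open>f ^ (d div 2)\<close>, and \<open>h\<close> undoes this
  scaling after everything has been multiplied by \<open>f ^ k\<close>.
\<close>

lemma resolvent_numerator:
  fixes A :: "('m::len0, 'r::comm_ring_1) grassmann mat"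
  assumes A: "A \<in> carrier_mat n n" and f_def: "f = char_poly (map_mat degree_zero A)"
    and k_def: "k = (LENGTH('m) + 1) div 2"
  obtains Q where "Q \<in> carrier_mat n n"
    "(scalar [:0, 1:] \<cdot>\<^sub>m 1\<^sub>m n - map_mat gconst A) * Q = scalar (f ^ Suc k) \<cdot>\<^sub>m 1\<^sub>m n"
proof -
  define B where "B = map_mat gconst A"
  define U V where "U = map_mat (weight (\<lambda>d. of_bool (even d))) B"
    and "V = map_mat (weight (\<lambda>d. of_bool (odd d))) B"
  \<comment> \<open>For odd degrees \<open>d div 2\<close> rounds down, so a product of two
    components of \<open>V'\<close> has one factor \<open>f\<close> less than its total degree asks
    for. The factor \<open>f\<close> contained in \<open>\<Psi>\<close> makes up for it in
    \<open>V' * \<Psi> * V'\<close>.\<close>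
  define U' V' where "U' = map_mat (weight (\<lambda>d. if even d then f ^ (d div 2) else 0)) B"
    and "V' = map_mat (weight (\<lambda>d. if odd d then f ^ (d div 2) else 0)) B"
  define x where "x = (scalar [:0, 1:] :: ('m, 'r poly) grassmann)"
  define P where "P = x \<cdot>\<^sub>m 1\<^sub>m n - U'"
  have B: "B \<in> carrier_mat n n"
    using A by (simp add: B_def)
  have UV [simp]: "U \<in> carrier_mat n n" "V \<in> carrier_mat n n" "U' \<in> carrier_mat n n" "V' \<in> carrier_mat n n"
    using B by (simp_all add: U_def V_def U'_def V'_def)
  have U': "U' \<in> even_mats n" and V': "V' \<in> odd_mats n"
    using B by (auto simp: U'_def V'_def intro!: even_matsI odd_matsI geven_weight godd_weight)
  have P: "P \<in> even_mats n"
    unfolding P_def x_def by (intro even_mats_diff even_mats_smult_one geven_scalar U')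
  have B_eq: "B = U + V"
    using B by (intro eq_matI) (simp_all add: U_def V_def flip: even_odd_decomposition)

  define C where "C = (map_mat scalar (char_poly_matrix (map_mat degree_zero A)) :: ('m, 'r poly) grassmann mat)"
  \<comment> \<open>Components of even degree at least 2 carry a factor \<open>f\<close> after
    scaling, so \<open>P\<close> agrees modulo \<open>I\<close> with \<open>C\<close>, whose
    determinant is \<open>f\<close>. Hence \<open>even_det P\<close> is \<open>f\<close> times
    \<open>1 + y\<close> with \<open>y\<close> nilpotent, that is, \<open>f\<close> times a
    unit.\<close>
  define I where "I = {scalar f * y | y :: ('m, 'r poly) grassmann. geven y \<and> degree_part 0 y = 0}"
  have C: "C \<in> even_mats n"
    using A by (auto simp: C_def char_poly_matrix_def intro!: even_matsI)
  have "even_det P - even_det C \<in> I"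
  proof (rule even_det_diff_in_ideal[OF P C])
    show "0 \<in> I"
      unfolding I_def by (rule CollectI, rule exI[of _ 0]) simp
    fix a b assume "a \<in> I" "b \<in> I"
    then obtain y z where "a = scalar f * y" "geven y" "degree_part 0 y = 0"
      "b = scalar f * z" "geven z" "degree_part 0 z = 0"
      unfolding I_def by blast
    then show "a + b \<in> I"
      unfolding I_def
      by (intro CollectI exI[of _ "y + z"]) (simp add: distrib_left geven_add degree_part_add)
  next
    fix a b :: "('m, 'r poly) grassmann" assume "geven b" "a \<in> I"
    then obtain y where "a = scalar f * y" "geven y" "degree_part 0 y = 0"
      unfolding I_def by blast
    moreover have "b * (scalar f * y) = scalar f * (b * y)"
      using scalar_commute[of f b] by (simp flip: mult.assoc)
    ultimately show "b * a \<in> I"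
      using \<open>geven b\<close> unfolding I_def
      by (intro CollectI exI[of _ "b * y"]) (simp add: geven_mult degree_part_mult)
  next
    fix i j assume ij: "i < n" "j < n"
    define b where "b = B $$ (i, j)"
    \<comment> \<open>One factor \<open>f\<close> is taken out, which lowers the exponent by 1; the
      sign comes from \<open>- U'\<close> in \<open>P\<close>, and degree 0 is left out because
      there \<open>P\<close> and \<open>C\<close> agree.\<close>
    define y where "y = weight (\<lambda>d. if even d \<and> 0 < d then - (f ^ (d div 2 - 1)) else 0) b"
    have "C $$ (i, j) = x * (1\<^sub>m n) $$ (i, j) - scalar [:degree_zero (A $$ (i, j)):]"
    proof -
      have "C $$ (i, j) = scalar ([:0, 1:] * (1\<^sub>m n) $$ (i, j) + [:- degree_zero (A $$ (i, j)):])"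
        using ij A by (simp add: C_def char_poly_matrix_def)
      also have "[:- degree_zero (A $$ (i, j)):] = - [:degree_zero (A $$ (i, j)):]"
        by simp
      also have "scalar ([:0, 1:] * (1\<^sub>m n) $$ (i, j) + - [:degree_zero (A $$ (i, j)):]) =
          scalar [:0, 1:] * scalar ((1\<^sub>m n) $$ (i, j)) - (scalar [:degree_zero (A $$ (i, j)):] :: ('m, 'r poly) grassmann)"
        by (simp only: add_uminus_conv_diff scalar_diff scalar_mult)
      also have "scalar ((1\<^sub>m n :: 'r poly mat) $$ (i, j)) = ((1\<^sub>m n) $$ (i, j) :: ('m, 'r poly) grassmann)"
        using ij by simp
      finally show ?thesis
        by (simp add: x_def)
    qed
    also have "scalar [:degree_zero (A $$ (i, j)):] = gconst (scalar (degree_zero (A $$ (i, j))))"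
      by (simp add: scalar_eq_monomial gconst.map_grassmann_monomial)
    also have "\<dots> = degree_part 0 b"
      using ij A by (simp add: scalar_degree_zero b_def B_def gconst.degree_part_map_grassmann)
    finally have C_eq: "C $$ (i, j) = x * (1\<^sub>m n) $$ (i, j) - degree_part 0 b" .
    have "P $$ (i, j) = x * (1\<^sub>m n) $$ (i, j) - U' $$ (i, j)"
      using ij carrier_matD[OF UV(3)] by (simp add: P_def)
    then have "P $$ (i, j) - C $$ (i, j) = degree_part 0 b - U' $$ (i, j)"
      by (simp add: C_eq)
    also have "\<dots> = scalar f * y"
    proof (rule grassmann_eqI)
      fix d
      have "U' $$ (i, j) = weight (\<lambda>d. if even d then f ^ (d div 2) else 0) b"
        using ij B by (simp add: U'_def b_def)
      moreover have "d div 2 = Suc (d div 2 - 1)" if "even d" "0 < d"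
        using that by auto
      then have "f ^ (d div 2) = f * f ^ (d div 2 - 1)" if "even d" "0 < d"
        using that by (metis power_Suc)
      ultimately show "degree_part d (degree_part 0 b - U' $$ (i, j)) = degree_part d (scalar f * y)"
        by (cases "d = 0") (auto simp: y_def degree_part_diff degree_part_weight degree_part_degree_part
            degree_part_scalar_mult scalar_uminus scalar_mult mult.assoc)
    qed
    finally show "P $$ (i, j) - C $$ (i, j) \<in> I"
      unfolding I_def
      by (intro CollectI exI[of _ y]) (simp add: y_def geven_weight degree_part_weight)
  qed
  moreover have "even_det C = scalar f"
    by (simp add: C_def even_det_scalar f_def char_poly_def)
  ultimately obtain y where y: "geven y" "degree_part 0 y = 0"
    and "even_det P - scalar f = scalar f * y"
    by (auto simp: I_def)
  then have det_P: "even_det P = scalar f * (1 + y)"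
    by (simp add: distrib_left diff_eq_eq add.commute)
  obtain u where u: "geven u" "(1 + y) * u = 1"
    using even_one_plus_unit[OF y] by blast
  have u_det: "u * even_det P = scalar f"
    using u by (simp add: geven_commute[of u] det_P mult.assoc)
  have cancel: "a = 0" if "even_det P * a = 0" for a
  proof -
    have "scalar f * a = u * (even_det P * a)"
      by (simp add: u_det flip: mult.assoc)
    then have "scalar f * a = 0"
      using that by simp
    moreover have "lead_coeff f = 1"
      using degree_monic_char_poly[of "map_mat degree_zero A" n] A by (simp add: f_def)
    ultimately show ?thesis
      using monic_scalar_cancel by blast
  qed

  have smult_smult: "u \<cdot>\<^sub>m (even_det P \<cdot>\<^sub>m 1\<^sub>m n) = scalar f \<cdot>\<^sub>m 1\<^sub>m n"
    by (intro eq_matI) (simp_all add: u_det)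
  \<comment> \<open>The unit \<open>u\<close> corrects the adjugate so that its product with
    \<open>P\<close> is \<open>f\<close> exactly: \<open>\<Psi>\<close> stands for \<open>f\<close>
    times the inverse of \<open>P\<close>.\<close>
  define \<Psi> where "\<Psi> = u \<cdot>\<^sub>m even_adj P"
  have \<Psi>: "\<Psi> \<in> even_mats n"
    unfolding \<Psi>_def by (intro even_mats_smult u even_adj P)
  interpret odd_perturbation n P \<Psi> "scalar f"
    using P \<Psi> cancel even_adj[OF P] u(1) smult_smult
    by unfold_locales
       (simp_all add: \<Psi>_def mult_even_smult[of _ n] even_mats_carrier)
  define Z where "Z = P - V' * \<Psi> * V'"
  have Z: "Z \<in> even_mats n"
    unfolding Z_def by (intro even_mats_diff P even_mats_mult_odd odd_mats_mult_left V' \<Psi>)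
  have det_Z: "even_det Z = even_det P"
    unfolding Z_def by (rule even_det_odd_perturbation[OF V'])
  \<comment> \<open>The same \<open>u\<close> works for \<open>Z\<close> because
    \<open>even_det Z = even_det P\<close>; this is where the invariance of the determinant enters.
    \<open>G\<close> stands for \<open>f\<close> times the inverse of \<open>Z\<close>.\<close>
  define G where "G = u \<cdot>\<^sub>m even_adj Z"
  have G: "G \<in> even_mats n"
    unfolding G_def by (intro even_mats_smult u even_adj Z)
  have ZG: "Z * G = scalar f \<cdot>\<^sub>m 1\<^sub>m n"
    using even_adj[OF Z] u(1) smult_smult
    by (simp add: G_def mult_even_smult[of _ n] even_mats_carrier Z det_Z)

  \<comment> \<open>The exponent is nonnegative without truncation for every \<open>d\<close> up to
    the rank, since \<open>k\<close> is half the rank rounded up. In degree 0 it equals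
    \<open>k\<close>, which with the factor \<open>f\<close> from \<open>Z * G\<close> gives
    \<open>f ^ Suc k\<close>.\<close>
  define h where "h d = f ^ (k - (d + 1) div 2)" for d :: nat
  define S where "S = (map_mat (weight h) :: ('m, 'r poly) grassmann mat \<Rightarrow> _)"
  \<comment> \<open>The odd part of the rescaled resolvent, matching the factor
    \<open>1 + R V\<close> of the overview, while \<open>G\<close> is the even part.\<close>
  define W where "W = \<Psi> * V' * G"
  have W: "W \<in> odd_mats n"
    unfolding W_def by (intro odd_mats_mult_left odd_mats_mult_right \<Psi> V' G)
  note [simp] = P[THEN carr(1)] \<Psi>[THEN carr(1)] Z[THEN carr(1)] G[THEN carr(1)] W[THEN carr(2)] B
  note [simp] = carr(3)
  have S [simp]: "M \<in> carrier_mat n n \<Longrightarrow> S M \<in> carrier_mat n n" for M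
    by (simp add: S_def)
  have S_smult: "S (scalar c \<cdot>\<^sub>m M) = scalar c \<cdot>\<^sub>m S M" for c M
    unfolding S_def by (rule map_weight_smult)
  have S_diff: "S (M - N) = S M - S N" if "M \<in> carrier_mat n n" "N \<in> carrier_mat n n" for M N
    unfolding S_def by (rule map_weight_diff[OF that])
  \<comment> \<open>An even degree \<open>a\<close> lowers the exponent in \<open>h\<close> by
    exactly \<open>a div 2\<close>, which is the power put into \<open>U'\<close>. Hence
    \<open>S\<close> trades \<open>U'\<close> for the unscaled \<open>U\<close>.\<close>
  have U_S: "U * S M = S (U' * M)" if "M \<in> carrier_mat n n" for M
    unfolding S_def U_def U'_def
  proof (rule map_weight_mult[symmetric, OF B that])
    fix a b assume ab: "a + b \<le> LENGTH('m)"
    then have "k - (a + b + 1) div 2 + a div 2 = k - (b + 1) div 2" if "even a"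
      using that by (auto elim!: evenE simp: k_def)
    then show "h (a + b) * (if even a then f ^ (a div 2) else 0) = of_bool (even a) * h b"
      by (simp add: h_def flip: power_add)
  qed
  \<comment> \<open>Two odd degrees: the rounding in \<open>h\<close> has already been paid for by
    \<open>b\<close>, so the exponents match as in the even case.\<close>
  have V_S_odd: "V * S M = S (V' * M)" if "M \<in> odd_mats n" for M
    unfolding S_def V_def V'_def
  proof (rule map_weight_mult[symmetric, OF B odd_mats_carrier[OF that]])
    fix a b i j assume ab: "a + b \<le> LENGTH('m)" and "i < n" "j < n" "degree_part b (M $$ (i, j)) \<noteq> 0"
    then have "odd b"
      using odd_matsD(3)[OF that] by (auto simp: godd_def)
    then have "k - (a + b + 1) div 2 + a div 2 = k - (b + 1) div 2" if "odd a"
      using that ab by (auto elim!: oddE simp: k_def)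
    then show "h (a + b) * (if odd a then f ^ (a div 2) else 0) = of_bool (odd a) * h b"
      by (simp add: h_def flip: power_add)
  qed
  \<comment> \<open>Here an odd \<open>a\<close> meets an even \<open>b\<close>, the rounding in
    \<open>h\<close> costs one more step, and a factor \<open>f\<close> is left over. It is the
    factor that appears in \<open>PW\<close>.\<close>
  have V_S_even: "V * S M = scalar f \<cdot>\<^sub>m S (V' * M)" if "M \<in> even_mats n" for M
  proof -
    have "V * S M = map_mat (weight (\<lambda>d. f * h d)) (V' * M)"
      unfolding S_def V_def V'_def
    proof (rule map_weight_mult[symmetric, OF B even_mats_carrier[OF that]])
      fix a b i j assume ab: "a + b \<le> LENGTH('m)" and "i < n" "j < n" "degree_part b (M $$ (i, j)) \<noteq> 0"
      then have "even b"
        using even_matsD(3)[OF that] by (auto simp: geven_def)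
      then have "Suc (k - (a + b + 1) div 2 + a div 2) = k - (b + 1) div 2" if "odd a"
        using that ab by (auto elim!: oddE evenE simp: k_def)
      then show "f * h (a + b) * (if odd a then f ^ (a div 2) else 0) = of_bool (odd a) * h b"
        by (simp add: h_def flip: power_add power_Suc)
    qed
    also have "\<dots> = scalar f \<cdot>\<^sub>m S (V' * M)"
      unfolding S_def by (intro eq_matI) (simp_all add: weight_mult_left)
    finally show ?thesis .
  qed
  have x_S: "(x \<cdot>\<^sub>m 1\<^sub>m n) * S M = S ((x \<cdot>\<^sub>m 1\<^sub>m n) * M)" if "M \<in> carrier_mat n n" for M
    using that by (simp add: smult_one_mult[of _ n] x_def S_smult)
  have x [simp]: "x \<cdot>\<^sub>m 1\<^sub>m n \<in> carrier_mat n n"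
    by simp
  have PW: "P * W = scalar f \<cdot>\<^sub>m (V' * G)"
  proof -
    have "P * W = (P * \<Psi>) * (V' * G)"
      unfolding W_def by (simp add: assoc)
    then show ?thesis
      by (simp add: P\<Psi> smult_one_mult)
  qed
  have rearrange: "(a1 + a2) - ((b1 + b2) + (c1 + c2)) = (a1 - b1 - c2) + (a2 - b2 - c1)"
    if "a1 \<in> carrier_mat n n" "a2 \<in> carrier_mat n n" "b1 \<in> carrier_mat n n" "b2 \<in> carrier_mat n n"
      "c1 \<in> carrier_mat n n" "c2 \<in> carrier_mat n n"
    for a1 a2 b1 b2 c1 c2 :: "('m, 'r poly) grassmann mat"
    using that by (intro eq_matI) auto
  show thesis
  proof (rule that)
    show "S G + S W \<in> carrier_mat n n"
      by simp
    \<comment> \<open>Sorting by parity, the even terms combine to \<open>S (Z * G)\<close> and the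
      odd terms cancel by \<open>PW\<close>.\<close>
    have "(x \<cdot>\<^sub>m 1\<^sub>m n - B) * (S G + S W) =
        ((x \<cdot>\<^sub>m 1\<^sub>m n) * S G + (x \<cdot>\<^sub>m 1\<^sub>m n) * S W) - ((U * S G + U * S W) + (V * S G + V * S W))"
    proof -
      have "(x \<cdot>\<^sub>m 1\<^sub>m n - B) * T = (x \<cdot>\<^sub>m 1\<^sub>m n) * T - (U * T + V * T)"
        if "T \<in> carrier_mat n n" for T
        using that by (simp add: B_eq minus_mult_distrib_mat[of _ n n _ _ n] add_mult_distrib_mat[of _ n n _ _ n])
      then show ?thesis
        by (simp add: mult_add_distrib_mat[of _ n n _ n])
    qed
    also have "\<dots> = (S ((x \<cdot>\<^sub>m 1\<^sub>m n) * G) - S (U' * G) - S (V' * W)) +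
        (S ((x \<cdot>\<^sub>m 1\<^sub>m n) * W) - S (U' * W) - S (scalar f \<cdot>\<^sub>m (V' * G)))"
      by (simp add: rearrange U_S x_S V_S_odd W V_S_even G S_smult)
    also have "\<dots> = S ((x \<cdot>\<^sub>m 1\<^sub>m n - U') * G - V' * W) + S ((x \<cdot>\<^sub>m 1\<^sub>m n - U') * W - scalar f \<cdot>\<^sub>m (V' * G))"
      by (simp add: S_diff minus_carrier_mat minus_mult_distrib_mat[of _ n n _ _ n])
    also have "(x \<cdot>\<^sub>m 1\<^sub>m n - U') * G - V' * W = Z * G"
      unfolding Z_def W_def P_def[symmetric] by (simp add: minus_mult_distrib_mat[of _ n n _ _ n] assoc)
    also have "(x \<cdot>\<^sub>m 1\<^sub>m n - U') * W - scalar f \<cdot>\<^sub>m (V' * G) = 0\<^sub>m n n"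
      unfolding P_def[symmetric] PW by (rule minus_r_inv_mat) simp
    also have "S (Z * G) + S (0\<^sub>m n n) = scalar (f ^ Suc k) \<cdot>\<^sub>m 1\<^sub>m n"
      unfolding ZG by (intro eq_matI)
        (simp_all add: S_def weight_scalar_mult weight_scalar[of h 1, simplified] h_def flip: scalar_mult)
    finally show "(scalar [:0, 1:] \<cdot>\<^sub>m 1\<^sub>m n - map_mat gconst A) * (S G + S W) = scalar (f ^ Suc k) \<cdot>\<^sub>m 1\<^sub>m n"
      by (simp add: x_def B_def)
  qed
qed

theorem theorem1:
  fixes A :: "('m::len0, 'r::comm_ring_1) grassmann mat"
    and A0 :: "'r mat" and f :: "'r poly" and n :: nat
  assumes "n \<ge> 1"
    and "A \<in> carrier_mat n n"
    and "A0 = map_mat degree_zero A"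
    and "f = char_poly A0"
  shows "eval_mat_poly f A ^\<^sub>m (nat \<lceil>real LENGTH('m) / 2\<rceil> + 1) = 0\<^sub>m n n"
proof -
  define k where "k = (LENGTH('m) + 1) div 2"
  obtain Q where "Q \<in> carrier_mat n n"
    "(scalar [:0, 1:] \<cdot>\<^sub>m 1\<^sub>m n - map_mat gconst A) * Q = scalar (f ^ Suc k) \<cdot>\<^sub>m 1\<^sub>m n"
    using resolvent_numerator[OF assms(2) assms(4)[unfolded assms(3)] k_def] by blast
  \<comment> \<open>The resolvent identity says that \<open>x - A\<close> divides the polynomial
    \<open>f ^ Suc k\<close>, so its remainder, the value at \<open>A\<close>, is zero.\<close>
  then have "eval_mat_poly (f ^ Suc k) A = 0\<^sub>m n n"
    by (rule eval_mat_poly_eq_0_if_divides[OF assms(2)])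
  moreover have "nat \<lceil>real LENGTH('m) / 2\<rceil> = k"
    unfolding k_def by linarith
  ultimately show ?thesis
    by (simp add: eval_mat_poly_power[OF assms(2)] del: pow_mat.simps power_Suc)
qed

end
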